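(* Let $n,k\geq1$. If $X\subseteq\mathbb{N}$ is finite, $\omega^{kn}\cdot4$-large and $(x\mapsto x^{R_x(2x+2)})$-sparse with $kn\leq\min X$, then for every coloring $f:[X]^2\to\{0,\dots,k-1\}$ there is an $\omega^n$-large $f$-homogeneous subset of $X$.
   Context: $H$ is $f$-homogeneous if $f$ is constant on $[H]^2$. $R_k(d)$ is the least $R$ such that every $f:[\{0,\dots,R-1\}]^2\to k$ admits a homogeneous set of size $d$. For $g:\mathbb{N}\to\mathbb{N}$, $X$ is $g$-sparse if $y>g(x)$ for all $x<y$ in $X$. Fundamental sequences: $\{0\}(x)=0$; for $\alpha\neq0$ write $\alpha=\delta+\omega^\gamma$ in Cantor normal form with $\omega^\gamma$ the last term; $\{\alpha\}(x)=\delta$ if $\gamma=0$, $\delta+\omega^{\gamma'}\cdot x$ if $\gamma=\gamma'+1$, $\delta+\omega^{\{\gamma\}(x)}$ if $\gamma$ is a limit. For finite $X=\{x_0<\dots<x_s\}$, $\{\alpha\}(X)=\{\cdots\{\{\alpha\}(x_0)\}(x_1)\cdots\}(x_s)$ and $X$ is $\alpha$-large iff $\{\alpha\}(X)=0$. *)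

theory Defs
  imports "HOL-Library.Ramsey"
begin

text \<open>
  Ordinals below \<open>\<epsilon>\<^sub>0\<close> as Cantor normal form terms.  The exponents are listed with the
  \<^emph>\<open>last\<close> (smallest) term first: \<open>CNF [\<gamma>\<^sub>0, \<gamma>\<^sub>1, \<dots>, \<gamma>\<^sub>m]\<close> stands for
  \<open>\<omega>\<^bsup>\<gamma>\<^sub>m\<^esup> + \<dots> + \<omega>\<^bsup>\<gamma>\<^sub>1\<^esup> + \<omega>\<^bsup>\<gamma>\<^sub>0\<^esup>\<close>, and \<open>CNF []\<close> is \<open>0\<close>.  So \<open>CNF (\<gamma> # \<delta>)\<close> is
  \<open>\<delta> + \<omega>\<^bsup>\<gamma>\<^esup>\<close>; it is a successor iff \<open>\<gamma> = CNF []\<close>, and then its predecessor is \<open>CNF \<delta>\<close>.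
\<close>

datatype cnf = CNF "cnf list"

text \<open>The ordering of ordinals: common leading terms form a common suffix of the lists.\<close>

inductive cnf_less :: "cnf \<Rightarrow> cnf \<Rightarrow> bool" where
  extend: "cs \<noteq> [] \<Longrightarrow> cnf_less (CNF as) (CNF (cs @ as))"
| differ: "cnf_less a b \<Longrightarrow> cnf_less (CNF (cs @ a # as)) (CNF (ds @ b # as))"

fun is_cnf :: "cnf \<Rightarrow> bool" where
  "is_cnf (CNF as) \<longleftrightarrow> (\<forall>a\<in>set as. is_cnf a) \<and> sorted_wrt (\<lambda>a b. cnf_less a b \<or> a = b) as"

definition omega_pow_times :: "cnf \<Rightarrow> nat \<Rightarrow> cnf" where
  "omega_pow_times \<gamma> m = CNF (replicate m \<gamma>)"

definition cnf_of_nat :: "nat \<Rightarrow> cnf" where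
  "cnf_of_nat m = omega_pow_times (CNF []) m"

text \<open>
  Fundamental sequences.  The clauses treat \<open>0\<close> and \<open>\<delta> + \<omega>\<^bsup>\<gamma>\<^esup>\<close> with \<open>\<gamma> = 0\<close>,
  \<open>\<gamma> = \<gamma>' + 1\<close> and \<open>\<gamma>\<close> a limit, in this order.
\<close>

fun fund :: "cnf \<Rightarrow> nat \<Rightarrow> cnf" where
  "fund (CNF []) x = CNF []"
| "fund (CNF (CNF [] # \<delta>)) x = CNF \<delta>"
| "fund (CNF (CNF (CNF [] # \<gamma>') # \<delta>)) x = CNF (replicate x (CNF \<gamma>') @ \<delta>)"
| "fund (CNF (CNF (CNF (e # es) # \<gamma>) # \<delta>)) x = CNF (fund (CNF (CNF (e # es) # \<gamma>)) x # \<delta>)"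

lemma append_eq_append_Cons:
  "cs @ as = cs' @ b # es \<Longrightarrow>
    (\<exists>us. cs = cs' @ b # us \<and> us @ as = es) \<or> (\<exists>us. as = us @ b # es)"
proof (induction cs arbitrary: cs')
  case (Cons c cs)
  then show ?case by (cases cs') auto
qed simp

lemma cnf_less_trans: "cnf_less a b \<Longrightarrow> cnf_less b c \<Longrightarrow> cnf_less a c"
proof (induction b arbitrary: a c)
  case (CNF bs)
  from CNF.prems(1) show ?case
  proof cases
    case 1: (extend cs as)
    from CNF.prems(2) show ?thesis
    proof cases
      case (extend cs')
      then show ?thesis using 1 cnf_less.extend[of "cs' @ cs" as] by simp
    next
      case 2: (differ b' c' cs' es ds')
      from 1 2 have "cs @ as = cs' @ b' # es" by simp
      then consider us where "cs = cs' @ b' # us" "us @ as = es"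
        | us where "as = us @ b' # es"
        by (blast dest: append_eq_append_Cons)
      then show ?thesis
      proof cases
        case (1 us)
        then show ?thesis using \<open>a = CNF as\<close> 2 cnf_less.extend[of "ds' @ c' # us" as] by simp
      next
        case (2 us)
        then show ?thesis using \<open>a = CNF as\<close> \<open>c = CNF (ds' @ c' # es)\<close> \<open>cnf_less b' c'\<close>
          by (simp add: cnf_less.differ)
      qed
    qed
  next
    case 1: (differ a' b' cs es ds)
    from CNF.prems(2) show ?thesis
    proof cases
      case (extend cs')
      then show ?thesis using 1 cnf_less.differ[of a' b' cs es "cs' @ ds"] by simp
    next
      case 2: (differ b'' c' cs' es' ds')
      from 1 2 have *: "bs = ds @ b' # es" "ds @ b' # es = cs' @ b'' # es'" by simp_all
      then consider "b' = b''" "es = es'" | us where "es = us @ b'' # es'"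
        | us where "es' = us @ b' # es"
        using append_eq_append_Cons[OF *(2)] by (auto simp: Cons_eq_append_conv)
      then show ?thesis
      proof cases
        case 1
        then have "cnf_less a' c'" using CNF.IH[of b' a' c'] * 2 \<open>cnf_less a' b'\<close> by auto
        then show ?thesis using 1 \<open>a = _\<close> 2 by (simp add: cnf_less.differ)
      next
        case (2 us)
        then show ?thesis
          using \<open>a = _\<close> \<open>c = _\<close> \<open>cnf_less b'' c'\<close> cnf_less.differ[of b'' c' "cs @ a' # us" es' ds']
          by simp
      next
        case (3 us)
        then show ?thesis
          using \<open>a = _\<close> \<open>c = _\<close> \<open>cnf_less a' b'\<close> cnf_less.differ[of a' b' cs es "ds' @ c' # us"]
          by simp
      qed
    qed
  qed
qed

lemma fund_less: "\<alpha> \<noteq> CNF [] \<Longrightarrow> cnf_less (fund \<alpha> x) \<alpha>"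
proof (induction \<alpha> x rule: fund.induct)
  case (2 \<delta> x)
  show ?case using cnf_less.extend[of "[CNF []]" \<delta>] by simp
next
  case (3 \<gamma>' \<delta> x)
  show ?case
  proof (cases x)
    case 0
    then show ?thesis using cnf_less.extend[of "[CNF (CNF [] # \<gamma>')]" \<delta>] by simp
  next
    case (Suc m)
    have "cnf_less (CNF \<gamma>') (CNF (CNF [] # \<gamma>'))"
      using cnf_less.extend[of "[CNF []]" \<gamma>'] by simp
    from cnf_less.differ[OF this, of "replicate m (CNF \<gamma>')" \<delta> "[]"]
    show ?thesis using Suc by (simp add: replicate_app_Cons_same)
  qed
next
  case (4 e es \<gamma> \<delta> x)
  then show ?case using cnf_less.differ[of _ _ "[]" \<delta> "[]"] by simp
qed simp

lemma is_cnf_fund: "is_cnf \<alpha> \<Longrightarrow> is_cnf (fund \<alpha> x)"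
proof (induction \<alpha> x rule: fund.induct)
  case (2 \<delta> x)
  then show ?case by simp
next
  case (3 \<gamma>' \<delta> x)
  have lt: "cnf_less (CNF \<gamma>') (CNF (CNF [] # \<gamma>'))"
    using cnf_less.extend[of "[CNF []]" \<gamma>'] by simp
  from 3 have \<delta>: "is_cnf (CNF (CNF [] # \<gamma>'))" "\<forall>a\<in>set \<delta>. is_cnf a"
    "sorted_wrt (\<lambda>a b. cnf_less a b \<or> a = b) \<delta>"
    "\<forall>a\<in>set \<delta>. cnf_less (CNF (CNF [] # \<gamma>')) a \<or> CNF (CNF [] # \<gamma>') = a"
    by auto
  from \<delta>(1) have "is_cnf (CNF \<gamma>')" by simp
  moreover have "\<forall>a\<in>set \<delta>. cnf_less (CNF \<gamma>') a"
    using \<delta>(4) lt cnf_less_trans by blast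
  moreover have "sorted_wrt (\<lambda>a b. cnf_less a b \<or> a = b) (replicate x (CNF \<gamma>'))"
    by (induction x) auto
  ultimately show ?case using \<delta>(2,3)
    by (auto simp: sorted_wrt_append)
next
  case (4 e es \<gamma> \<delta> x)
  let ?\<gamma> = "CNF (CNF (e # es) # \<gamma>)"
  from "4.prems" have \<delta>: "is_cnf ?\<gamma>" "\<forall>a\<in>set \<delta>. is_cnf a"
    "sorted_wrt (\<lambda>a b. cnf_less a b \<or> a = b) \<delta>"
    "\<forall>a\<in>set \<delta>. cnf_less ?\<gamma> a \<or> ?\<gamma> = a"
    by auto
  have "\<forall>a\<in>set \<delta>. cnf_less (fund ?\<gamma> x) a"
    using \<delta>(4) fund_less[of ?\<gamma> x] cnf_less_trans by blast
  then show ?case using \<delta> "4.IH" by auto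
qed simp

lemma is_cnf_omega_pow_times: "is_cnf \<gamma> \<Longrightarrow> is_cnf (omega_pow_times \<gamma> m)"
proof -
  have "sorted_wrt (\<lambda>a b. cnf_less a b \<or> a = b) (replicate m \<gamma>)"
    by (induction m) auto
  then show "is_cnf \<gamma> \<Longrightarrow> ?thesis"
    by (auto simp: omega_pow_times_def)
qed

lemma is_cnf_of_nat: "is_cnf (cnf_of_nat m)"
  unfolding cnf_of_nat_def by (intro is_cnf_omega_pow_times) simp

definition fund_set :: "cnf \<Rightarrow> nat set \<Rightarrow> cnf" where
  "fund_set \<alpha> X = foldl fund \<alpha> (sorted_list_of_set X)"

definition large :: "cnf \<Rightarrow> nat set \<Rightarrow> bool" where
  "large \<alpha> X \<longleftrightarrow> finite X \<and> fund_set \<alpha> X = CNF []"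

definition sparse :: "(nat \<Rightarrow> nat) \<Rightarrow> nat set \<Rightarrow> bool" where
  "sparse g X \<longleftrightarrow> (\<forall>x\<in>X. \<forall>y\<in>X. x < y \<longrightarrow> g x < y)"

definition homogeneous :: "('a set \<Rightarrow> 'b) \<Rightarrow> 'a set \<Rightarrow> bool" where
  "homogeneous f H \<longleftrightarrow> (\<exists>c. \<forall>e\<in>[H]\<^bsup>2\<^esup>. f e = c)"

definition ramsey_number :: "nat \<Rightarrow> nat \<Rightarrow> nat" where
  "ramsey_number k d = (LEAST R. \<forall>f\<in>[{..<R}]\<^bsup>2\<^esup> \<rightarrow> {..<k}. \<exists>H\<subseteq>{..<R}. card H = d \<and> homogeneous f H)"

text \<open>The \<open>LEAST\<close> above is taken over a nonempty set.\<close>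

lemma ramsey_number_exists:
  "\<exists>R. \<forall>f\<in>[{..<R::nat}]\<^bsup>2\<^esup> \<rightarrow> {..<k::nat}. \<exists>H\<subseteq>{..<R}. card H = d \<and> homogeneous f H"
proof -
  obtain N :: nat where N: "partn_lst {..<N} (replicate k d) 2"
    using ramsey_full by blast
  have "\<exists>H\<subseteq>{..<N}. card H = d \<and> homogeneous f H" if f: "f \<in> [{..<N}]\<^bsup>2\<^esup> \<rightarrow> {..<k}" for f
  proof -
    obtain i H where "i < k" "H \<in> [{..<N}]\<^bsup>(replicate k d ! i)\<^esup>" "f ` [H]\<^bsup>2\<^esup> \<subseteq> {i}"
      using partn_lstE[OF N f] by auto
    then have "H \<subseteq> {..<N}" "card H = d" "\<forall>e\<in>[H]\<^bsup>2\<^esup>. f e = i"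
      by (auto simp: nsets_def)
    then show ?thesis unfolding homogeneous_def by blast
  qed
  then show ?thesis by blast
qed

end

theory Submission
  imports Defs
begin

text \<open>
  Assign to each color \<open>i < k\<close> its own target \<open>\<omega>\<^bsup>b i\<^esup> \<cdot> m i\<close>, and show by induction on
  \<open>s = \<Sum>i<k. b i\<close> that a sparse set containing a Ramsey number of consecutive \<open>\<omega>\<^sup>s\<close>-large blocks
  has a homogeneous set meeting the target of its color.  Sparsity allows us to thin out the blocks
  so that the color of a pair from two different blocks depends on the blocks only, at the price of
  replacing the \<open>\<omega>\<^sup>s\<close>-large blocks by \<open>\<omega>\<^bsup>s-1\<^esup> \<cdot> N\<close>-large ones, with \<open>N\<close> huge compared to everything
  before the block.  By Ramsey's theorem many blocks have the same color \<open>c\<close> between them.  Inside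
  each of them the induction hypothesis applies to the same targets with \<open>b c\<close> lowered by one, and
  the pieces of color \<open>c\<close> so obtained add up to a set meeting the old target.  The theorem starts
  from a point \<open>x\<close> with constant color \<open>c\<close> to the rest, and the targets \<open>\<omega>\<^bsup>n-1\<^esup> \<cdot> x\<close> for \<open>c\<close> and
  \<open>\<omega>\<^sup>n\<close> for the other colors.
\<close>

section \<open>Consecutive sets\<close>

definition less_sets :: "'a::ord set \<Rightarrow> 'a set \<Rightarrow> bool" (infix "\<lless>" 50) where
  "A \<lless> B \<longleftrightarrow> (\<forall>a\<in>A. \<forall>b\<in>B. a < b)"

lemma less_setsD: "A \<lless> B \<Longrightarrow> a \<in> A \<Longrightarrow> b \<in> B \<Longrightarrow> a < b"
  by (simp add: less_sets_def)

lemma less_sets_mono: "A \<lless> B \<Longrightarrow> A' \<subseteq> A \<Longrightarrow> B' \<subseteq> B \<Longrightarrow> A' \<lless> B'"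
  by (auto simp: less_sets_def)

definition contains_consecutive :: "('a::ord set \<Rightarrow> bool) \<Rightarrow> nat \<Rightarrow> 'a set \<Rightarrow> bool" where
  "contains_consecutive P m X \<longleftrightarrow>
    (\<exists>B. (\<forall>j<m. B j \<subseteq> X \<and> P (B j)) \<and> (\<forall>j<m. \<forall>i<j. B i \<lless> B j))"

lemma contains_consecutiveI:
  assumes "\<And>j. j < m \<Longrightarrow> B j \<subseteq> X" "\<And>j. j < m \<Longrightarrow> P (B j)"
    and "\<And>i j. i < j \<Longrightarrow> j < m \<Longrightarrow> B i \<lless> B j"
  shows "contains_consecutive P m X"
  unfolding contains_consecutive_def using assms by (intro exI[of _ B]) simp

lemma contains_consecutiveE:
  assumes "contains_consecutive P m X"
  obtains B where "\<And>j. j < m \<Longrightarrow> B j \<subseteq> X" "\<And>j. j < m \<Longrightarrow> P (B j)"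
    "\<And>i j. i < j \<Longrightarrow> j < m \<Longrightarrow> B i \<lless> B j"
proof -
  from assms obtain B where "(\<forall>j<m. B j \<subseteq> X \<and> P (B j)) \<and> (\<forall>j<m. \<forall>i<j. B i \<lless> B j)"
    unfolding contains_consecutive_def ..
  then show ?thesis by (intro that[of B]) auto
qed

lemma contains_consecutive_0 [simp]: "contains_consecutive P 0 X"
  by (simp add: contains_consecutive_def)

lemma contains_consecutive_mono:
  assumes "contains_consecutive P m X" "m' \<le> m" "X \<subseteq> X'"
  shows "contains_consecutive P m' X'"
proof -
  from assms(1) obtain B where B: "\<And>j. j < m \<Longrightarrow> B j \<subseteq> X" "\<And>j. j < m \<Longrightarrow> P (B j)"
    "\<And>i j. i < j \<Longrightarrow> j < m \<Longrightarrow> B i \<lless> B j"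
    by (rule contains_consecutiveE) (rule that)
  then show ?thesis
    using assms(2,3) by (intro contains_consecutiveI[of _ B]) (meson less_le_trans subset_trans)+
qed

lemma contains_consecutive_imp:
  assumes "contains_consecutive P m X" "\<And>B. P B \<Longrightarrow> Q B"
  shows "contains_consecutive Q m X"
  using assms unfolding contains_consecutive_def by meson

lemma contains_consecutive_Suc:
  "contains_consecutive P (Suc m) X \<longleftrightarrow>
    (\<exists>B\<subseteq>X. \<exists>Z\<subseteq>X. B \<lless> Z \<and> P B \<and> contains_consecutive P m Z)" (is "?L \<longleftrightarrow> ?R")
proof
  assume ?L
  then obtain B where B: "\<And>j. j < Suc m \<Longrightarrow> B j \<subseteq> X" "\<And>j. j < Suc m \<Longrightarrow> P (B j)"
    "\<And>i j. i < j \<Longrightarrow> j < Suc m \<Longrightarrow> B i \<lless> B j"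
    by (rule contains_consecutiveE) (rule that)
  let ?Z = "\<Union>j<m. B (Suc j)"
  have "contains_consecutive P m ?Z"
    using B(2,3) by (intro contains_consecutiveI[of _ "\<lambda>j. B (Suc j)"]) auto
  moreover have "B 0 \<lless> ?Z" using B(3) by (fastforce simp: less_sets_def)
  moreover have "?Z \<subseteq> X" using B(1) by (intro UN_least) simp
  ultimately show ?R using B(1,2)[of 0] by blast
next
  assume ?R
  then obtain B Z where BZ: "B \<subseteq> X" "Z \<subseteq> X" "B \<lless> Z" "P B" "contains_consecutive P m Z"
    by blast
  from BZ(5) obtain C where C: "\<And>j. j < m \<Longrightarrow> C j \<subseteq> Z" "\<And>j. j < m \<Longrightarrow> P (C j)"
    "\<And>i j. i < j \<Longrightarrow> j < m \<Longrightarrow> C i \<lless> C j"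
    by (rule contains_consecutiveE) (rule that)
  show ?L
  proof (rule contains_consecutiveI[of _ "case_nat B C"])
    show "case_nat B C j \<subseteq> X" "P (case_nat B C j)" if "j < Suc m" for j
      using that BZ(1,2,4) C(1)[of "j - 1"] C(2)[of "j - 1"] by (cases j; force)+
    show "case_nat B C i \<lless> case_nat B C j" if "i < j" "j < Suc m" for i j
    proof -
      from that obtain j' where "j = Suc j'" "j' < m" by (cases j) auto
      with \<open>i < j\<close> show ?thesis
        using C(1)[of j'] C(3)[of "i - 1" j'] less_sets_mono[OF BZ(3)] by (cases i) auto
    qed
  qed
qed

lemma contains_consecutive_tl:
  assumes "contains_consecutive P (Suc m) X" "\<not> P {}"
  shows "\<exists>u\<in>X. contains_consecutive P m (X \<inter> {u<..})"
proof -
  from assms(1) obtain B Z where BZ: "B \<subseteq> X" "Z \<subseteq> X" "B \<lless> Z" "P B" "contains_consecutive P m Z"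
    by (auto simp: contains_consecutive_Suc)
  with assms(2) obtain u where "u \<in> B" by (metis ex_in_conv)
  with BZ have "Z \<subseteq> X \<inter> {u<..}" by (auto dest: less_setsD)
  with BZ(1,5) \<open>u \<in> B\<close> show ?thesis by (blast intro: contains_consecutive_mono)
qed

lemma contains_consecutive_butlast:
  fixes X :: "'a::linorder set"
  assumes "contains_consecutive P (Suc m) X" "\<not> P {}" "finite X"
  shows "contains_consecutive P m (X \<inter> {..<Max X})"
proof -
  from assms(1) obtain B where B: "\<And>j. j < Suc m \<Longrightarrow> B j \<subseteq> X" "\<And>j. j < Suc m \<Longrightarrow> P (B j)"
    "\<And>i j. i < j \<Longrightarrow> j < Suc m \<Longrightarrow> B i \<lless> B j"
    by (rule contains_consecutiveE) (rule that)
  have "B m \<noteq> {}" using B(2)[of m] assms(2) by auto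
  then obtain u where u: "u \<in> B m" by blast
  then have "u \<le> Max X" using B(1)[of m] assms(3) by auto
  have "B j \<subseteq> {..<Max X}" if "j < m" for j
    using less_setsD[OF B(3)[OF that] _ u] \<open>u \<le> Max X\<close> by force
  with B show ?thesis by (intro contains_consecutiveI[of _ B]) auto
qed

lemma contains_consecutive_nonempty:
  "contains_consecutive P m X \<Longrightarrow> 0 < m \<Longrightarrow> \<not> P {} \<Longrightarrow> X \<noteq> {}"
  using contains_consecutive_tl[of P "m - 1" X] by auto

section \<open>Largeness below \<open>\<omega>\<^sup>\<omega>\<close>\<close>

text \<open>\<open>pow_large s X\<close>: the set \<open>X\<close> has an \<open>\<omega>\<^sup>s\<close>-large subset.\<close>

primrec pow_large :: "nat \<Rightarrow> nat set \<Rightarrow> bool" where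
  "pow_large 0 X \<longleftrightarrow> X \<noteq> {}"
| "pow_large (Suc s) X \<longleftrightarrow> (\<exists>x\<in>X. contains_consecutive (pow_large s) x (X \<inter> {x<..}))"

abbreviation pow_times_large :: "nat \<Rightarrow> nat \<Rightarrow> nat set \<Rightarrow> bool" where
  "pow_times_large s \<equiv> contains_consecutive (pow_large s)"

lemma not_pow_large_empty: "\<not> pow_large s {}"
  by (cases s) auto

lemma pow_times_large_nonempty: "pow_times_large s m X \<Longrightarrow> 0 < m \<Longrightarrow> X \<noteq> {}"
  using contains_consecutive_nonempty not_pow_large_empty by blast

lemma pow_times_large_tl:
  "pow_times_large s (Suc m) X \<Longrightarrow> \<exists>u\<in>X. pow_times_large s m (X \<inter> {u<..})"
  using contains_consecutive_tl not_pow_large_empty by blast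

lemma pow_times_large_butlast:
  "pow_times_large s (Suc m) X \<Longrightarrow> finite X \<Longrightarrow> pow_times_large s m (X \<inter> {..<Max X})"
  using contains_consecutive_butlast not_pow_large_empty by blast

lemma pow_large_SucI:
  assumes "x \<in> X" "Y \<subseteq> X" "{x} \<lless> Y" "pow_times_large s x Y"
  shows "pow_large (Suc s) X"
proof -
  have "Y \<subseteq> X \<inter> {x<..}" using assms(2,3) by (auto simp: less_sets_def)
  then show ?thesis using assms(1,4) by (auto intro: contains_consecutive_mono)
qed

lemma pow_times_large_0_iff:
  assumes "finite X"
  shows "pow_times_large 0 m X \<longleftrightarrow> m \<le> card X"
proof
  assume "pow_times_large 0 m X"
  then show "m \<le> card X" using assms
  proof (induction m arbitrary: X)
    case (Suc m)
    have "m \<le> card (X \<inter> {..<Max X})"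
      using Suc.prems(2) by (intro Suc.IH pow_times_large_butlast[OF Suc.prems]) simp
    also have "\<dots> < card X"
    proof (rule psubset_card_mono[OF Suc.prems(2)])
      have "Max X \<in> X"
        using Suc.prems(2) pow_times_large_nonempty[OF Suc.prems(1)] by simp
      then show "X \<inter> {..<Max X} \<subset> X" by auto
    qed
    finally show ?case by simp
  qed simp
next
  assume "m \<le> card X"
  then show "pow_times_large 0 m X"
    using assms by (intro contains_consecutiveI[of _ "\<lambda>j. {enumerate X j}"])
      (auto simp: less_sets_def finite_enumerate_in_set finite_enumerate_mono)
qed

text \<open>Each set gives up its maximum, which opens the next copy of \<open>\<omega>\<^bsup>s+1\<^esup>\<close>.\<close>

lemma pow_times_large_UN_atMost:
  assumes fin: "\<And>i. i \<le> m \<Longrightarrow> finite (F i)" and "F 0 \<noteq> {}"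
    and less: "\<And>i j. i < j \<Longrightarrow> j \<le> m \<Longrightarrow> F i \<lless> F j"
    and large: "\<And>i u. i < m \<Longrightarrow> u \<in> F i \<Longrightarrow> pow_times_large s (Suc u) (F (Suc i))"
  shows "pow_times_large (Suc s) m (\<Union>i\<le>m. F i)"
proof -
  have ne: "F i \<noteq> {}" if "i \<le> m" for i using that
  proof (induction i)
    case (Suc i)
    then obtain u where "u \<in> F i" by auto
    with large[of i u] Suc.prems show ?case by (auto dest: pow_times_large_nonempty)
  qed (simp add: assms(2))
  define M where "M i = Max (F i)" for i
  have M: "M i \<in> F i" if "i \<le> m" for i
    unfolding M_def using fin ne that by (intro Max_in)
  define C where "C i = insert (M i) (F (Suc i) \<inter> {..<M (Suc i)})" for i
  have less_M: "C i \<subseteq> {..<M (Suc i)}" if "i < m" for i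
    using that M less_setsD[OF less[of i "Suc i"]] by (auto simp: C_def)
  have M_le: "x \<in> C i \<Longrightarrow> M i \<le> x" if "i < m" for i x
    using that M[of i] less_setsD[OF less[of i "Suc i"]] by (auto simp: C_def intro: less_imp_le)
  have M_mono: "M i \<le> M j" if "i \<le> j" "j \<le> m" for i j
    using that M[of i] M[of j] less_setsD[OF less[of i j]]
    by (cases "i = j") (auto intro: less_imp_le)
  show ?thesis
  proof (rule contains_consecutiveI)
    show "C j \<subseteq> (\<Union>i\<le>m. F i)" if "j < m" for j
    proof -
      from that have "j \<in> {..m}" "Suc j \<in> {..m}" "M j \<in> F j" using M by simp_all
      then show ?thesis unfolding C_def by blast
    qed
    show "pow_large (Suc s) (C j)" if "j < m" for j
    proof (rule pow_large_SucI)
      show "pow_times_large s (M j) (F (Suc j) \<inter> {..<M (Suc j)})"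
        using that pow_times_large_butlast[OF large] M fin unfolding M_def by simp
      show "{M j} \<lless> F (Suc j) \<inter> {..<M (Suc j)}"
        using that M[of j] less_setsD[OF less[of j "Suc j"]] by (auto simp: less_sets_def)
    qed (auto simp: C_def)
    show "C i \<lless> C j" if "i < j" "j < m" for i j
      using that less_M[of i] M_mono[of "Suc i" j] M_le[of j] by (force simp: less_sets_def)
  qed
qed

lemma pow_times_large_UN:
  fixes J :: "'i::wellorder set"
  assumes J: "finite J" "m < card J"
    and fin: "\<And>j. j \<in> J \<Longrightarrow> finite (F j)" and ne: "\<And>j. j \<in> J \<Longrightarrow> F j \<noteq> {}"
    and less: "\<And>i j. i \<in> J \<Longrightarrow> j \<in> J \<Longrightarrow> i < j \<Longrightarrow> F i \<lless> F j"
    and large: "\<And>i j u. i \<in> J \<Longrightarrow> j \<in> J \<Longrightarrow> i < j \<Longrightarrow> u \<in> F i \<Longrightarrow> pow_times_large s (Suc u) (F j)"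
  shows "pow_times_large (Suc s) m (\<Union>j\<in>J. F j)"
proof -
  let ?h = "enumerate J"
  have h: "?h i \<in> J" if "i \<le> m" for i
    using J that by (simp add: finite_enumerate_in_set)
  have h_mono: "?h i < ?h j" if "i < j" "j \<le> m" for i j
    using J that by (simp add: finite_enumerate_mono)
  have "pow_times_large (Suc s) m (\<Union>i\<le>m. F (?h i))"
  proof (rule pow_times_large_UN_atMost)
    show "pow_times_large s (Suc u) (F (?h (Suc i)))" if "i < m" "u \<in> F (?h i)" for i u
      using that large[OF h h h_mono, of i "Suc i"] by simp
  qed (use fin ne less h h_mono in auto)
  then show ?thesis
    by (rule contains_consecutive_mono) (use h in auto)
qed

section \<open>Comparison with fundamental sequences\<close>

lemma fund_cnf_of_nat_0: "fund (CNF (cnf_of_nat 0 # \<delta>)) x = CNF \<delta>"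
  by (simp add: cnf_of_nat_def omega_pow_times_def)

lemma fund_cnf_of_nat_Suc:
  "fund (CNF (cnf_of_nat (Suc s) # \<delta>)) x = CNF (replicate x (cnf_of_nat s) @ \<delta>)"
  by (simp add: cnf_of_nat_def omega_pow_times_def)

lemma foldl_fund_replicate_split:
  assumes single: "\<And>\<delta> xs. sorted_wrt (<) xs \<Longrightarrow> foldl fund (CNF (\<gamma> # \<delta>)) xs = CNF [] \<Longrightarrow>
      \<exists>ys zs. xs = ys @ zs \<and> P (set ys) \<and> foldl fund (CNF \<delta>) zs = CNF []"
    and "sorted_wrt (<) xs" "foldl fund (CNF (replicate m \<gamma> @ \<delta>)) xs = CNF []"
  shows "\<exists>ys zs. xs = ys @ zs \<and> contains_consecutive P m (set ys) \<and> foldl fund (CNF \<delta>) zs = CNF []"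
  using assms(2,3)
proof (induction m arbitrary: xs)
  case 0
  then show ?case by (intro exI[of _ "[]"] exI[of _ xs]) simp
next
  case (Suc m)
  then have "foldl fund (CNF (\<gamma> # replicate m \<gamma> @ \<delta>)) xs = CNF []" by simp
  from single[OF Suc.prems(1) this] obtain bs xs' where
    bs: "xs = bs @ xs'" "P (set bs)" and xs': "foldl fund (CNF (replicate m \<gamma> @ \<delta>)) xs' = CNF []"
    by blast
  have "sorted_wrt (<) xs'" using Suc.prems(1) bs(1) by (simp add: sorted_wrt_append)
  from Suc.IH[OF this xs'] obtain ys zs where
    yz: "xs' = ys @ zs" "contains_consecutive P m (set ys)" "foldl fund (CNF \<delta>) zs = CNF []"
    by blast
  have "set bs \<lless> set ys"
    using Suc.prems(1) bs(1) yz(1) by (auto simp: sorted_wrt_append less_sets_def)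
  with bs(2) yz(2) have "contains_consecutive P (Suc m) (set (bs @ ys))"
    unfolding contains_consecutive_Suc by (intro exI[of _ "set bs"] exI[of _ "set ys"] conjI) auto
  with bs(1) yz(1,3) show ?case by (intro exI[of _ "bs @ ys"] exI[of _ zs]) simp
qed

lemma foldl_fund_split:
  assumes "sorted_wrt (<) xs" "foldl fund (CNF (cnf_of_nat s # \<delta>)) xs = CNF []"
  shows "\<exists>ys zs. xs = ys @ zs \<and> pow_large s (set ys) \<and> foldl fund (CNF \<delta>) zs = CNF []"
  using assms
proof (induction s arbitrary: \<delta> xs)
  case 0
  then obtain x xs' where "xs = x # xs'" by (cases xs) auto
  with 0 show ?case
    by (intro exI[of _ "[x]"] exI[of _ xs']) (simp add: fund_cnf_of_nat_0)
next
  case (Suc s)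
  then obtain x xs' where xs: "xs = x # xs'" by (cases xs) auto
  with Suc.prems have xs': "sorted_wrt (<) xs'"
      "foldl fund (CNF (replicate x (cnf_of_nat s) @ \<delta>)) xs' = CNF []"
    by (simp_all add: fund_cnf_of_nat_Suc)
  from foldl_fund_replicate_split[OF Suc.IH xs'] obtain ys zs where
    yz: "xs' = ys @ zs" "pow_times_large s x (set ys)" "foldl fund (CNF \<delta>) zs = CNF []" by blast
  have "{x} \<lless> set ys" using Suc.prems(1) xs yz(1) by (auto simp: less_sets_def)
  with yz(2) have "pow_large (Suc s) (set (x # ys))"
    by (intro pow_large_SucI[of x _ "set ys"]) auto
  with xs yz(1,3) show ?case by (intro exI[of _ "x # ys"] exI[of _ zs]) simp
qed

definition fund_erases :: "cnf list \<Rightarrow> nat set \<Rightarrow> bool" where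
  "fund_erases \<gamma>s X \<longleftrightarrow> (\<exists>xs. sorted_wrt (<) xs \<and> set xs \<subseteq> X \<and>
    (\<forall>\<delta>. foldl fund (CNF (\<gamma>s @ \<delta>)) xs = CNF \<delta>))"

lemma fund_erasesI:
  assumes "sorted_wrt (<) xs" "set xs \<subseteq> X" "\<And>\<delta>. foldl fund (CNF (\<gamma>s @ \<delta>)) xs = CNF \<delta>"
  shows "fund_erases \<gamma>s X"
  using assms unfolding fund_erases_def by blast

lemma fund_erases_replicate:
  assumes "contains_consecutive (fund_erases [\<gamma>]) m X"
  shows "fund_erases (replicate m \<gamma>) X"
  using assms
proof (induction m arbitrary: X)
  case 0
  show ?case by (rule fund_erasesI[of "[]"]) simp_all
next
  case (Suc m)
  then obtain B Z where BZ: "B \<subseteq> X" "Z \<subseteq> X" "B \<lless> Z"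
    "fund_erases [\<gamma>] B" "fund_erases (replicate m \<gamma>) Z"
    unfolding contains_consecutive_Suc by blast
  from BZ(4) obtain bs where bs: "sorted_wrt (<) bs" "set bs \<subseteq> B"
    "\<And>\<delta>. foldl fund (CNF ([\<gamma>] @ \<delta>)) bs = CNF \<delta>" unfolding fund_erases_def by blast
  from BZ(5) obtain zs where zs: "sorted_wrt (<) zs" "set zs \<subseteq> Z"
    "\<And>\<delta>. foldl fund (CNF (replicate m \<gamma> @ \<delta>)) zs = CNF \<delta>" unfolding fund_erases_def by blast
  show ?case
  proof (rule fund_erasesI[of "bs @ zs"])
    show "sorted_wrt (<) (bs @ zs)"
      using bs(1,2) zs(1,2) BZ(3) by (auto simp: sorted_wrt_append less_sets_def)
    show "foldl fund (CNF (replicate (Suc m) \<gamma> @ \<delta>)) (bs @ zs) = CNF \<delta>" for \<delta>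
      using bs(3)[of "replicate m \<gamma> @ \<delta>"] zs(3) by simp
  qed (use bs(2) zs(2) BZ(1,2) in auto)
qed

lemma pow_large_imp_fund_erases: "pow_large s X \<Longrightarrow> fund_erases [cnf_of_nat s] X"
proof (induction s arbitrary: X)
  case 0
  then obtain x where "x \<in> X" by auto
  then show ?case by (intro fund_erasesI[of "[x]"]) (simp_all add: fund_cnf_of_nat_0)
next
  case (Suc s)
  then obtain x where x: "x \<in> X" "pow_times_large s x (X \<inter> {x<..})" by auto
  then have "fund_erases (replicate x (cnf_of_nat s)) (X \<inter> {x<..})"
    using Suc.IH by (intro fund_erases_replicate) (auto elim: contains_consecutive_imp)
  then obtain xs where xs: "sorted_wrt (<) xs" "set xs \<subseteq> X \<inter> {x<..}"
    "\<And>\<delta>. foldl fund (CNF (replicate x (cnf_of_nat s) @ \<delta>)) xs = CNF \<delta>"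
    unfolding fund_erases_def by blast
  show ?case
    by (rule fund_erasesI[of "x # xs"]) (use x(1) xs in \<open>auto simp: fund_cnf_of_nat_Suc\<close>)
qed

lemma large_imp_pow_times_large:
  assumes "large (omega_pow_times (cnf_of_nat s) m) X"
  shows "pow_times_large s m X"
proof -
  let ?xs = "sorted_list_of_set X"
  have X: "finite X" "foldl fund (CNF (replicate m (cnf_of_nat s) @ [])) ?xs = CNF []"
    using assms by (simp_all add: large_def fund_set_def omega_pow_times_def)
  obtain ys zs where yz: "?xs = ys @ zs" "pow_times_large s m (set ys)"
    using foldl_fund_replicate_split[OF foldl_fund_split strict_sorted_list_of_set X(2)] by blast
  have "set ys \<subseteq> set ?xs" unfolding yz(1) by simp
  then show ?thesis using X(1) yz(2) by (auto elim: contains_consecutive_mono)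
qed

lemma pow_times_large_imp_large:
  assumes "pow_times_large s m X"
  shows "\<exists>H\<subseteq>X. large (omega_pow_times (cnf_of_nat s) m) H"
proof -
  have "fund_erases (replicate m (cnf_of_nat s)) X"
    using assms pow_large_imp_fund_erases
    by (intro fund_erases_replicate) (auto elim: contains_consecutive_imp)
  then obtain xs where xs: "sorted_wrt (<) xs" "set xs \<subseteq> X"
      "foldl fund (CNF (replicate m (cnf_of_nat s) @ [])) xs = CNF []"
    unfolding fund_erases_def by blast
  have "sorted_list_of_set (set xs) = xs"
    using xs(1) by (simp add: sorted_list_of_set.idem_if_sorted_distinct strict_sorted_iff)
  then have "large (omega_pow_times (cnf_of_nat s) m) (set xs)"
    using xs(3) by (simp add: large_def fund_set_def omega_pow_times_def)
  with xs(2) show ?thesis by blast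
qed

section \<open>The pigeonhole principle for sparse sets\<close>

lemma sparseD: "sparse g X \<Longrightarrow> x \<in> X \<Longrightarrow> y \<in> X \<Longrightarrow> x < y \<Longrightarrow> g x < y"
  by (simp add: sparse_def)

lemma sparse_mono:
  assumes "sparse g X" "Y \<subseteq> X" "\<And>x. x \<in> Y \<Longrightarrow> h x \<le> g x"
  shows "sparse h Y"
  using assms unfolding sparse_def by (meson le_less_trans subsetD)

lemma pigeonhole_card_less:
  assumes "f \<in> A \<rightarrow> B" "finite A" "finite B" "card B * m < card A"
  shows "\<exists>y\<in>B. m < card {x \<in> A. f x = y}"
proof -
  from assms(4) have "A \<noteq> {}" by auto
  with assms(1) have "B \<noteq> {}" by auto
  then obtain y where "y \<in> B" "card A \<le> card (f -` {y} \<inter> A) * card B"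
    using pigeonhole_card[OF assms(1-3)] by blast
  moreover have "f -` {y} \<inter> A = {x \<in> A. f x = y}" by auto
  ultimately show ?thesis
    using assms(4) by (metis less_le_trans mult.commute mult_less_cancel1)
qed

lemma pow_large_Suc_monochromatic_subset:
  assumes "sparse (\<lambda>x. q * Suc x) X" "B \<subseteq> X" "pow_large (Suc s) B"
    and IH: "\<And>Y m. Y \<subseteq> X \<Longrightarrow> pow_times_large s (Suc (q * m)) Y \<Longrightarrow>
      \<exists>c\<in>C. pow_times_large s m {y \<in> Y. \<chi> y = c}"
  shows "\<exists>F c. F \<subseteq> B \<and> \<chi> ` F = {c} \<and>
    (\<forall>u\<in>X. {u} \<lless> B \<longrightarrow> pow_times_large s (Suc u) F)"
proof -
  from assms(3) obtain x where x: "x \<in> B" "pow_times_large s x (B \<inter> {x<..})" by auto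
  define P where "P = {u \<in> X. {u} \<lless> B}"
  have "P \<subseteq> {..<x}" using x(1) by (auto simp: P_def less_sets_def)
  then have fin: "finite P" by (rule finite_subset) simp
  show ?thesis
  proof (cases "P = {}")
    case True
    then show ?thesis using x(1) unfolding P_def
      by (intro exI[of _ "{x}"] exI[of _ "\<chi> x"]) auto
  next
    case False
    then have "Max P \<in> P" using fin by simp
    then have "q * Suc (Max P) < x"
      using assms(1,2) x(1) by (auto simp: P_def less_sets_def intro: sparseD)
    then have "pow_times_large s (Suc (q * Suc (Max P))) (B \<inter> {x<..})"
      using x(2) by (intro contains_consecutive_mono[OF x(2)]) auto
    from IH[OF _ this] obtain c where
      c: "pow_times_large s (Suc (Max P)) {y \<in> B \<inter> {x<..}. \<chi> y = c}"
        (is "contains_consecutive _ _ ?F")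
      using assms(2) by blast
    have "pow_times_large s (Suc u) ?F" if "u \<in> X" "{u} \<lless> B" for u
      using that fin by (intro contains_consecutive_mono[OF c]) (auto simp: P_def)
    moreover have "\<chi> ` ?F = {c}" using pow_times_large_nonempty[OF c] by auto
    moreover have "?F \<subseteq> B" by blast
    ultimately show ?thesis by blast
  qed
qed

lemma pow_times_large_UN_blocks:
  fixes J :: "'i::wellorder set"
  assumes "finite X" "finite J" "m < card J"
    and B: "\<And>j. j \<in> J \<Longrightarrow> B j \<subseteq> X" "\<And>i j. i \<in> J \<Longrightarrow> j \<in> J \<Longrightarrow> i < j \<Longrightarrow> B i \<lless> B j"
    and F: "\<And>j. j \<in> J \<Longrightarrow> F j \<subseteq> B j" "\<And>j. j \<in> J \<Longrightarrow> F j \<noteq> {}"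
    and large: "\<And>j u. j \<in> J \<Longrightarrow> u \<in> X \<Longrightarrow> {u} \<lless> B j \<Longrightarrow> pow_times_large s (Suc u) (F j)"
  shows "pow_times_large (Suc s) m (\<Union>j\<in>J. F j)"
  using assms(2,3)
proof (rule pow_times_large_UN)
  show "finite (F j)" if "j \<in> J" for j
    using F(1)[OF that] B(1)[OF that] \<open>finite X\<close> by (meson finite_subset)
  show "F i \<lless> F j" if "i \<in> J" "j \<in> J" "i < j" for i j
    using B(2)[OF that] F(1)[OF that(1)] F(1)[OF that(2)] by (rule less_sets_mono)
  show "pow_times_large s (Suc u) (F j)" if "i \<in> J" "j \<in> J" "i < j" "u \<in> F i" for i j u
  proof (rule large[OF that(2)])
    show "u \<in> X" using that(1,4) F(1) B(1) by blast
    show "{u} \<lless> B j"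
      using B(2)[OF that(1-3)] F(1)[OF that(1)] that(4) by (auto simp: less_sets_def)
  qed
qed (fact F(2))

lemma pow_times_large_Suc_pigeonhole:
  fixes \<chi> :: "nat \<Rightarrow> 'c"
  assumes "finite X" "\<chi> \<in> X \<rightarrow> C" "finite C" "card C \<le> q"
    and "pow_times_large (Suc s) (Suc (q * m)) X"
    and monochromatic: "\<And>B. B \<subseteq> X \<Longrightarrow> pow_large (Suc s) B \<Longrightarrow> \<exists>F c. F \<subseteq> B \<and> \<chi> ` F = {c} \<and>
      (\<forall>u\<in>X. {u} \<lless> B \<longrightarrow> pow_times_large s (Suc u) F)"
  shows "\<exists>c\<in>C. pow_times_large (Suc s) m {x \<in> X. \<chi> x = c}"
proof -
  obtain B where B: "\<And>j. j \<le> q * m \<Longrightarrow> B j \<subseteq> X"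
    "\<And>j. j \<le> q * m \<Longrightarrow> pow_large (Suc s) (B j)"
    "\<And>i j. i < j \<Longrightarrow> j \<le> q * m \<Longrightarrow> B i \<lless> B j"
    by (rule contains_consecutiveE[OF assms(5), unfolded less_Suc_eq_le]) (rule that)
  have "\<exists>F c. F \<subseteq> B j \<and> \<chi> ` F = {c} \<and>
      (\<forall>u\<in>X. {u} \<lless> B j \<longrightarrow> pow_times_large s (Suc u) F)" if "j \<le> q * m" for j
    using B(1,2)[OF that] by (rule monochromatic)
  then obtain F c where F_c: "\<And>j. j \<le> q * m \<Longrightarrow> F j \<subseteq> B j \<and> \<chi> ` F j = {c j} \<and>
      (\<forall>u\<in>X. {u} \<lless> B j \<longrightarrow> pow_times_large s (Suc u) (F j))"
    by metis
  then have F: "F j \<subseteq> B j" "\<chi> ` F j = {c j}" "F j \<noteq> {}" "F j \<subseteq> X" if "j \<le> q * m" for j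
    using B(1)[OF that] that by blast+
  have "c \<in> {..q * m} \<rightarrow> C"
  proof
    fix j assume "j \<in> {..q * m}"
    then have "{c j} \<subseteq> \<chi> ` X" using F(2,4)[of j] by (metis atMost_iff image_mono)
    then show "c j \<in> C" using funcset_image[OF assms(2)] by auto
  qed
  then obtain v where v: "v \<in> C" "m < card {j \<in> {..q * m}. c j = v}"
    using pigeonhole_card_less[of c "{..q * m}" C m] assms(3,4) by (auto simp: less_Suc_eq_le)
  let ?J = "{j \<in> {..q * m}. c j = v}"
  have "pow_times_large (Suc s) m (\<Union>j\<in>?J. F j)"
  proof (rule pow_times_large_UN_blocks[OF assms(1) _ v(2)])
    show "pow_times_large s (Suc u) (F j)" if "j \<in> ?J" "u \<in> X" "{u} \<lless> B j" for j u
      using F_c[of j] that by simp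
  qed (use B F in auto)
  moreover have "(\<Union>j\<in>?J. F j) \<subseteq> {x \<in> X. \<chi> x = v}"
    using F(2,4) by blast
  ultimately show ?thesis
    using v(1) by (blast intro: contains_consecutive_mono)
qed

lemma pow_times_large_pigeonhole:
  fixes \<chi> :: "nat \<Rightarrow> 'c"
  assumes "finite X" "\<chi> \<in> X \<rightarrow> C" "finite C" "card C \<le> q" "sparse (\<lambda>x. q * Suc x) X"
    and "pow_times_large s (Suc (q * m)) X"
  shows "\<exists>c\<in>C. pow_times_large s m {x \<in> X. \<chi> x = c}"
  using assms(1,2,5,6)
proof (induction s arbitrary: X m)
  case 0
  have "q * m < card X"
    using 0(4) unfolding pow_times_large_0_iff[OF 0(1)] by simp
  then obtain c where "c \<in> C" "m < card {x \<in> X. \<chi> x = c}"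
    using pigeonhole_card_less[OF 0(2,1) assms(3), of m] assms(4)
    by (meson le_less_trans mult_le_mono1)
  then have "pow_times_large 0 m {x \<in> X. \<chi> x = c}"
    using 0(1) by (subst pow_times_large_0_iff) auto
  with \<open>c \<in> C\<close> show ?case ..
next
  case (Suc s)
  show ?case
  proof (rule pow_times_large_Suc_pigeonhole[OF Suc.prems(1,2) assms(3,4) Suc.prems(4)])
    fix B assume B: "B \<subseteq> X" "pow_large (Suc s) B"
    show "\<exists>F c. F \<subseteq> B \<and> \<chi> ` F = {c} \<and> (\<forall>u\<in>X. {u} \<lless> B \<longrightarrow> pow_times_large s (Suc u) F)"
    proof (rule pow_large_Suc_monochromatic_subset[OF Suc.prems(3) B])
      fix Y n assume "Y \<subseteq> X" "pow_times_large s (Suc (q * n)) Y"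
      with Suc.prems(1-3) show "\<exists>c\<in>C. pow_times_large s n {y \<in> Y. \<chi> y = c}"
        by (intro Suc.IH) (auto intro: finite_subset sparse_mono)
    qed
  qed
qed

lemma pow_times_large_ex_constant_subset:
  assumes "finite X" "finite I" "finite C" "card C ^ card I \<le> q"
    and \<phi>: "\<And>i x. i \<in> I \<Longrightarrow> x \<in> X \<Longrightarrow> \<phi> i x \<in> C"
    and "sparse (\<lambda>x. q * Suc x) X" "pow_times_large s (Suc (q * m)) X"
  shows "\<exists>D\<subseteq>X. pow_times_large s m D \<and> (\<forall>i\<in>I. \<forall>x\<in>D. \<forall>y\<in>D. \<phi> i x = \<phi> i y)"
proof -
  define \<chi> where "\<chi> x = restrict (\<lambda>i. \<phi> i x) I" for x
  have "\<chi> \<in> X \<rightarrow> (I \<rightarrow>\<^sub>E C)" using \<phi> by (auto simp: \<chi>_def)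
  moreover have "finite (I \<rightarrow>\<^sub>E C)" "card (I \<rightarrow>\<^sub>E C) \<le> q"
    using assms(2-4) by (simp_all add: finite_PiE card_PiE)
  ultimately obtain c where "pow_times_large s m {x \<in> X. \<chi> x = c}"
    using pow_times_large_pigeonhole[OF assms(1) _ _ _ assms(6,7)] by blast
  moreover have "\<phi> i x = \<phi> i y" if "i \<in> I" "\<chi> x = \<chi> y" for i x y
    using fun_cong[OF that(2), of i] that(1) by (simp add: \<chi>_def)
  ultimately show ?thesis by (intro exI[of _ "{x \<in> X. \<chi> x = c}"]) auto
qed

section \<open>Ramsey numbers\<close>

lemma funcset_nsets_2_iff:
  fixes A :: "'a::linorder set"
  shows "f \<in> [A]\<^bsup>2\<^esup> \<rightarrow> D \<longleftrightarrow> (\<forall>x\<in>A. \<forall>y\<in>A. x < y \<longrightarrow> f {x, y} \<in> D)"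
  by (auto simp: ordered_nsets_2_eq)

lemma funcset_nsets_subset: "f \<in> [A]\<^bsup>n\<^esup> \<rightarrow> D \<Longrightarrow> H \<subseteq> A \<Longrightarrow> f \<in> [H]\<^bsup>n\<^esup> \<rightarrow> D"
  using nsets_Pi_contra by blast

lemma homogeneous_subset: "homogeneous f H \<Longrightarrow> H' \<subseteq> H \<Longrightarrow> homogeneous f H'"
  unfolding homogeneous_def using nsets_mono by blast

lemma homogeneous_iff: "homogeneous f H \<longleftrightarrow> (\<exists>c. f \<in> [H]\<^bsup>2\<^esup> \<rightarrow> {c})"
  by (auto simp: homogeneous_def)

lemma partnE:
  assumes "partn A d n D" "f \<in> [A]\<^bsup>n\<^esup> \<rightarrow> D"
  obtains c H where "c \<in> D" "H \<in> [A]\<^bsup>d\<^esup>" "f \<in> [H]\<^bsup>n\<^esup> \<rightarrow> {c}"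
  using assms unfolding partn_def monochromatic_def image_subset_iff_funcset by blast

lemma partnI:
  assumes "\<And>f. f \<in> [A]\<^bsup>n\<^esup> \<rightarrow> D \<Longrightarrow> \<exists>c\<in>D. \<exists>H\<in>[A]\<^bsup>d\<^esup>. f \<in> [H]\<^bsup>n\<^esup> \<rightarrow> {c}"
  shows "partn A d n D"
  using assms unfolding partn_def monochromatic_def image_subset_iff_funcset by blast

lemma not_partnE:
  assumes "\<not> partn A d n D"
  obtains f where "f \<in> [A]\<^bsup>n\<^esup> \<rightarrow> D"
    "\<And>c H. c \<in> D \<Longrightarrow> H \<in> [A]\<^bsup>d\<^esup> \<Longrightarrow> f \<notin> [H]\<^bsup>n\<^esup> \<rightarrow> {c}"
  using assms unfolding partn_def monochromatic_def image_subset_iff_funcset by blast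

lemma partn_card_mono:
  assumes "partn A d n D" "finite A" "finite B" "card A \<le> card B"
  shows "partn B d n D"
proof (rule partnI)
  fix f assume f: "f \<in> [B]\<^bsup>n\<^esup> \<rightarrow> D"
  obtain \<phi> where \<phi>: "\<phi> ` A \<subseteq> B" "inj_on \<phi> A"
    using card_le_inj[OF assms(2-4)] by blast
  then have "\<phi> \<in> A \<rightarrow> B" by blast
  from nsets_compose_image_funcset[OF f this \<phi>(2)] obtain c H
    where H: "c \<in> D" "H \<in> [A]\<^bsup>d\<^esup>" "f \<circ> (`) \<phi> \<in> [H]\<^bsup>n\<^esup> \<rightarrow> {c}"
    by (rule partnE[OF assms(1)]) (rule that)
  have "\<phi> ` H \<in> [B]\<^bsup>d\<^esup>"
    using nsets_image_funcset[OF \<open>\<phi> \<in> A \<rightarrow> B\<close> \<phi>(2)] H(2) by blast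
  moreover have "f \<in> [\<phi> ` H]\<^bsup>n\<^esup> \<rightarrow> {c}"
  proof
    fix e assume "e \<in> [\<phi> ` H]\<^bsup>n\<^esup>"
    moreover have "inj_on \<phi> H" using \<phi>(2) H(2) by (auto simp: nsets_def intro: inj_on_subset)
    ultimately obtain e' where "e' \<in> [H]\<^bsup>n\<^esup>" "e = \<phi> ` e'" by (rule nset_image_obtains)
    with H(3) show "f e \<in> {c}" by auto
  qed
  ultimately show "\<exists>c\<in>D. \<exists>H\<in>[B]\<^bsup>d\<^esup>. f \<in> [H]\<^bsup>n\<^esup> \<rightarrow> {c}" using H(1) by blast
qed

lemma ex_funcset_singleton:
  assumes "f \<in> S \<rightarrow> D" "f \<in> S \<rightarrow> {c}" "D \<noteq> {}"
  shows "\<exists>c\<in>D. f \<in> S \<rightarrow> {c}"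
proof (cases "S = {}")
  case False
  then obtain x where "x \<in> S" by blast
  with assms(1,2) have "c \<in> D" by auto
  with assms(2) show ?thesis by blast
qed (use assms(3) in auto)

lemma partn_mono:
  assumes "partn A d n D" "d' \<le> d" "D' \<subseteq> D" "D' \<noteq> {}"
  shows "partn A d' n D'"
proof (rule partnI)
  fix f assume f: "f \<in> [A]\<^bsup>n\<^esup> \<rightarrow> D'"
  then have "f \<in> [A]\<^bsup>n\<^esup> \<rightarrow> D" using assms(3) by blast
  with assms(1) obtain c H where H: "H \<in> [A]\<^bsup>d\<^esup>" "f \<in> [H]\<^bsup>n\<^esup> \<rightarrow> {c}" by (rule partnE)
  from H(1) assms(2) obtain H' where H': "H' \<subseteq> H" "card H' = d'" "finite H'"
    using obtain_subset_with_card_n[of d' H] by (auto simp: nsets_def)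
  with H(1) have "H' \<in> [A]\<^bsup>d'\<^esup>" "H' \<subseteq> A" by (auto simp: nsets_def)
  moreover have "f \<in> [H']\<^bsup>n\<^esup> \<rightarrow> {c}" using H(2) H'(1) by (rule funcset_nsets_subset)
  moreover have "f \<in> [H']\<^bsup>n\<^esup> \<rightarrow> D'" using f \<open>H' \<subseteq> A\<close> by (rule funcset_nsets_subset)
  ultimately show "\<exists>c\<in>D'. \<exists>H\<in>[A]\<^bsup>d'\<^esup>. f \<in> [H]\<^bsup>n\<^esup> \<rightarrow> {c}"
    using ex_funcset_singleton[OF _ _ assms(4)] by blast
qed

lemma partn_2_iff_homogeneous:
  assumes "finite A" "D \<noteq> {}"
  shows "partn A d 2 D \<longleftrightarrow> (\<forall>f\<in>[A]\<^bsup>2\<^esup> \<rightarrow> D. \<exists>H\<subseteq>A. card H = d \<and> homogeneous f H)"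
proof
  assume partn: "partn A d 2 D"
  show "\<forall>f\<in>[A]\<^bsup>2\<^esup> \<rightarrow> D. \<exists>H\<subseteq>A. card H = d \<and> homogeneous f H"
  proof
    fix f assume "f \<in> [A]\<^bsup>2\<^esup> \<rightarrow> D"
    with partn obtain c H where "H \<in> [A]\<^bsup>d\<^esup>" "f \<in> [H]\<^bsup>2\<^esup> \<rightarrow> {c}" by (rule partnE)
    then show "\<exists>H\<subseteq>A. card H = d \<and> homogeneous f H"
      unfolding homogeneous_iff nsets_def[of A d] by blast
  qed
next
  assume homogeneous: "\<forall>f\<in>[A]\<^bsup>2\<^esup> \<rightarrow> D. \<exists>H\<subseteq>A. card H = d \<and> homogeneous f H"
  show "partn A d 2 D"
  proof (rule partnI)
    fix f assume f: "f \<in> [A]\<^bsup>2\<^esup> \<rightarrow> D"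
    with homogeneous obtain H c where H: "H \<subseteq> A" "card H = d" "f \<in> [H]\<^bsup>2\<^esup> \<rightarrow> {c}"
      unfolding homogeneous_iff by blast
    moreover have "f \<in> [H]\<^bsup>2\<^esup> \<rightarrow> D" using f H(1) by (rule funcset_nsets_subset)
    moreover have "H \<in> [A]\<^bsup>d\<^esup>"
      using H(1,2) finite_subset[OF H(1) assms(1)] by (simp add: nsets_def)
    ultimately show "\<exists>c\<in>D. \<exists>H\<in>[A]\<^bsup>d\<^esup>. f \<in> [H]\<^bsup>2\<^esup> \<rightarrow> {c}"
      using ex_funcset_singleton[OF _ _ assms(2)] by blast
  qed
qed

lemma ramsey_number_le_card_iff:
  assumes "0 < k" "finite A"
  shows "ramsey_number k d \<le> card A \<longleftrightarrow> partn A d 2 {..<k}"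
proof -
  have iff: "partn {..<R} d 2 {..<k} \<longleftrightarrow>
      (\<forall>f\<in>[{..<R}]\<^bsup>2\<^esup> \<rightarrow> {..<k}. \<exists>H\<subseteq>{..<R}. card H = d \<and> homogeneous f H)" for R :: nat
    using assms(1) by (intro partn_2_iff_homogeneous) auto
  have eq: "ramsey_number k d = (LEAST R. partn {..<R} d 2 {..<k})"
    unfolding ramsey_number_def iff ..
  show ?thesis
  proof
    have "\<exists>R::nat. partn {..<R} d 2 {..<k}"
      unfolding iff by (rule ramsey_number_exists)
    then have "partn {..<ramsey_number k d} d 2 {..<k}"
      unfolding eq by (rule LeastI_ex)
    moreover assume "ramsey_number k d \<le> card A"
    ultimately show "partn A d 2 {..<k}"
      using assms(2) by (auto elim: partn_card_mono)
  next
    assume "partn A d 2 {..<k}"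
    then have "partn {..<card A} d 2 {..<k}" using assms(2) by (rule partn_card_mono) simp_all
    then show "ramsey_number k d \<le> card A" unfolding eq by (rule Least_le)
  qed
qed

lemma partn_ramsey_number: "0 < k \<Longrightarrow> partn {..<ramsey_number k d} d 2 {..<k}"
  by (simp flip: ramsey_number_le_card_iff)

lemma ramsey_number_homogeneousE:
  assumes "0 < k" "f \<in> [{..<ramsey_number k d}]\<^bsup>2\<^esup> \<rightarrow> {..<k}"
  obtains c h where "c < k" "\<And>i. i < d \<Longrightarrow> h i < ramsey_number k d"
    "\<And>i j. i < j \<Longrightarrow> j < d \<Longrightarrow> h i < h j" "\<And>i j. i < j \<Longrightarrow> j < d \<Longrightarrow> f {h i, h j} = c"
proof -
  from partn_ramsey_number[OF assms(1)] assms(2) obtain c J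
    where c: "c \<in> {..<k}" and J: "J \<in> [{..<ramsey_number k d}]\<^bsup>d\<^esup>" "f \<in> [J]\<^bsup>2\<^esup> \<rightarrow> {c}"
    by (rule partnE)
  define h where "h = enumerate J"
  from J(1) have fin: "finite J" "card J = d" and "J \<subseteq> {..<ramsey_number k d}"
    by (auto simp: nsets_def)
  then have h: "h i \<in> J" "h i < ramsey_number k d" if "i < d" for i
    using finite_enumerate_in_set[of J i] that by (auto simp: h_def)
  have less: "h i < h j" if "i < j" "j < d" for i j
    using that fin by (simp add: h_def finite_enumerate_mono)
  have "f {h i, h j} = c" if "i < j" "j < d" for i j
    using J(2) h(1)[of i] h(1)[OF that(2)] less[OF that] that by (simp add: funcset_nsets_2_iff)
  with c h(2) less show ?thesis by (intro that[of c h]) simp_all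
qed

lemma ramsey_number_mono:
  assumes "0 < k" "k \<le> k'" "d \<le> d'"
  shows "ramsey_number k d \<le> ramsey_number k' d'"
proof -
  have "partn {..<ramsey_number k' d'} d 2 {..<k}"
    using assms by (intro partn_mono[OF partn_ramsey_number[of k' d']]) auto
  then show ?thesis using assms(1) by (simp flip: ramsey_number_le_card_iff)
qed

lemma le_ramsey_number:
  assumes "0 < k"
  shows "d \<le> ramsey_number k d"
proof -
  have "(\<lambda>_. 0) \<in> [{..<ramsey_number k d}]\<^bsup>2\<^esup> \<rightarrow> {..<k}" using assms by auto
  with partn_ramsey_number[OF assms, of d] obtain H where "H \<in> [{..<ramsey_number k d}]\<^bsup>d\<^esup>"
    by (rule partnE)
  then show ?thesis using card_mono[of "{..<ramsey_number k d}" H] by (auto simp: nsets_def)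
qed

lemma card_Int_less_if_not_homogeneous:
  assumes "h \<in> [H]\<^bsup>n\<^esup> \<rightarrow> {c}" "\<And>e. e \<in> [S]\<^bsup>n\<^esup> \<Longrightarrow> h e = f e"
    and "\<And>K. K \<in> [S]\<^bsup>d\<^esup> \<Longrightarrow> f \<notin> [K]\<^bsup>n\<^esup> \<rightarrow> {c}"
  shows "card (H \<inter> S) < d"
proof (rule ccontr)
  assume "\<not> card (H \<inter> S) < d"
  then obtain K where "K \<subseteq> H \<inter> S" "card K = d" "finite K"
    using obtain_subset_with_card_n[of d "H \<inter> S"] by auto
  then have K: "K \<subseteq> H" "K \<subseteq> S" "K \<in> [S]\<^bsup>d\<^esup>" by (auto simp: nsets_def)
  have "f \<in> [K]\<^bsup>n\<^esup> \<rightarrow> {c}"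
  proof
    fix e assume e: "e \<in> [K]\<^bsup>n\<^esup>"
    then have "h e = f e" using assms(2) nsets_mono[OF K(2)] by blast
    with funcset_mem[OF funcset_nsets_subset[OF assms(1) K(1)] e] show "f e \<in> {c}" by simp
  qed
  with assms(3)[OF K(3)] show False ..
qed

lemma not_partn_Un:
  assumes "\<not> partn A (Suc a) n D" "\<not> partn B (Suc b) n D"
    and "0 < n" "A \<inter> B = {}" "D \<noteq> {}"
  shows "\<not> partn (A \<union> B) (Suc (a + b)) n D"
proof
  assume AB: "partn (A \<union> B) (Suc (a + b)) n D"
  obtain f where f: "f \<in> [A]\<^bsup>n\<^esup> \<rightarrow> D"
      "\<And>c H. c \<in> D \<Longrightarrow> H \<in> [A]\<^bsup>Suc a\<^esup> \<Longrightarrow> f \<notin> [H]\<^bsup>n\<^esup> \<rightarrow> {c}"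
    using assms(1) by (rule not_partnE) (rule that)
  obtain g where g: "g \<in> [B]\<^bsup>n\<^esup> \<rightarrow> D"
      "\<And>c H. c \<in> D \<Longrightarrow> H \<in> [B]\<^bsup>Suc b\<^esup> \<Longrightarrow> g \<notin> [H]\<^bsup>n\<^esup> \<rightarrow> {c}"
    using assms(2) by (rule not_partnE) (rule that)
  from assms(5) obtain \<delta> where "\<delta> \<in> D" by blast
  define h where "h e = (if e \<subseteq> A then f e else if e \<subseteq> B then g e else \<delta>)" for e
  have h_f: "h e = f e" if "e \<in> [A]\<^bsup>n\<^esup>" for e
    using that by (auto simp: h_def nsets_def)
  have h_g: "h e = g e" if "e \<in> [B]\<^bsup>n\<^esup>" for e
  proof -
    have "e \<noteq> {}" "e \<subseteq> B" using that assms(3) by (auto simp: nsets_def)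
    with assms(4) show ?thesis by (auto simp: h_def)
  qed
  have "h \<in> [A \<union> B]\<^bsup>n\<^esup> \<rightarrow> D"
    using f(1) g(1) \<open>\<delta> \<in> D\<close> by (auto simp: h_def nsets_def Pi_iff)
  with AB obtain c H where c: "c \<in> D" and H: "H \<in> [A \<union> B]\<^bsup>Suc (a + b)\<^esup>" "h \<in> [H]\<^bsup>n\<^esup> \<rightarrow> {c}"
    by (rule partnE)
  have "H = (H \<inter> A) \<union> (H \<inter> B)" "finite H" "card H = Suc (a + b)"
    using H(1) by (auto simp: nsets_def)
  then have "Suc (a + b) \<le> card (H \<inter> A) + card (H \<inter> B)" by (metis card_Un_le)
  moreover have "card (H \<inter> A) < Suc a"
    using H(2) h_f f(2)[OF c] by (rule card_Int_less_if_not_homogeneous)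
  moreover have "card (H \<inter> B) < Suc b"
    using H(2) h_g g(2)[OF c] by (rule card_Int_less_if_not_homogeneous)
  ultimately show False by simp
qed

lemma ramsey_number_add:
  assumes "0 < k"
  shows "ramsey_number k (Suc a) + ramsey_number k (Suc b) \<le> Suc (ramsey_number k (Suc (a + b)))"
proof -
  obtain M N where MN: "ramsey_number k (Suc a) = Suc M" "ramsey_number k (Suc b) = Suc N"
    using le_ramsey_number[OF assms] by (metis Suc_le_D)
  have "\<not> partn {..<M} (Suc a) 2 {..<k}" "\<not> partn {M..<M + N} (Suc b) 2 {..<k}"
    using MN by (simp_all flip: ramsey_number_le_card_iff[OF assms])
  then have "\<not> partn ({..<M} \<union> {M..<M + N}) (Suc (a + b)) 2 {..<k}"
    using assms by (intro not_partn_Un) auto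
  moreover have "{..<M} \<union> {M..<M + N} = {..<M + N}" by auto
  ultimately have "\<not> ramsey_number k (Suc (a + b)) \<le> M + N"
    using assms by (simp flip: ramsey_number_le_card_iff)
  then show ?thesis using MN by simp
qed

lemma ramsey_number_3_ge:
  assumes "0 < k"
  shows "k + 2 \<le> ramsey_number k 3"
proof -
  have "\<not> partn {..k} 3 2 {..<k}"
  proof
    assume "partn {..k} 3 2 {..<k}"
    moreover have "Min \<in> [{..k}]\<^bsup>2\<^esup> \<rightarrow> {..<k}" by (auto simp: funcset_nsets_2_iff)
    ultimately obtain c H where H: "H \<in> [{..k}]\<^bsup>3\<^esup>" "Min \<in> [H]\<^bsup>2\<^esup> \<rightarrow> {c}" by (rule partnE)
    from H(1) have fin: "finite H" "card H = 3" by (auto simp: nsets_def)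
    then have "Max H \<in> H" by (intro Max_in) auto
    have "x = c" if "x \<in> H" "x \<noteq> Max H" for x
    proof -
      have "x < Max H" using that fin(1) by (simp add: le_neq_trans)
      with that(1) \<open>Max H \<in> H\<close> H(2) have "Min {x, Max H} = c" unfolding funcset_nsets_2_iff by blast
      with \<open>x < Max H\<close> show ?thesis by simp
    qed
    then have "H \<subseteq> {c, Max H}" by blast
    then have "card H \<le> card {c, Max H}" by (intro card_mono) simp_all
    also have "\<dots> \<le> 2" by (simp add: card_insert_if)
    finally have "card H \<le> 2" .
    with fin(2) show False by simp
  qed
  then show ?thesis using assms by (simp flip: ramsey_number_le_card_iff)
qed

lemma ramsey_number_double_ge:
  assumes "0 < k"
  shows "k + ramsey_number k k + ramsey_number k (Suc k) \<le> ramsey_number k (2 * k + 2)"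
proof -
  obtain k' where k': "k = Suc k'" using assms by (cases k) auto
  have "ramsey_number k k + ramsey_number k (Suc k) \<le> Suc (ramsey_number k (2 * k))"
    using ramsey_number_add[OF assms, of k' k] k' by (simp add: mult_2)
  moreover have "ramsey_number k (2 * k) + ramsey_number k 3 \<le> Suc (ramsey_number k (2 * k + 2))"
    using ramsey_number_add[OF assms, of "2 * k - 1" 2] k' by (simp add: numeral_3_eq_3)
  ultimately show ?thesis using ramsey_number_3_ge[OF assms] by linarith
qed

abbreviation ramsey_sparse :: "nat set \<Rightarrow> bool" where
  "ramsey_sparse \<equiv> sparse (\<lambda>x. x ^ ramsey_number x (2 * x + 2))"

lemma ramsey_sparse_quadratic:
  assumes "ramsey_sparse X" "\<And>x. x \<in> X \<Longrightarrow> 2 \<le> x"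
  shows "sparse (\<lambda>x. x * Suc x) X"
  using assms(1) order_refl
proof (rule sparse_mono)
  fix x assume "x \<in> X"
  then have x: "2 \<le> x" by (rule assms(2))
  have "x * Suc x \<le> x * (x * x)" using x by (intro mult_le_mono2) (simp add: Suc_le_eq)
  also have "\<dots> = x ^ 3" by (simp add: power3_eq_cube)
  also have "\<dots> \<le> x ^ ramsey_number x (2 * x + 2)"
    using x le_ramsey_number[of x "2 * x + 2"] by (intro power_increasing) auto
  finally show "x * Suc x \<le> x ^ ramsey_number x (2 * x + 2)" .
qed

lemma ramsey_sparse_exponential:
  assumes "ramsey_sparse X" "0 < k" "\<And>x. x \<in> X \<Longrightarrow> 2 \<le> x \<and> k \<le> x \<and> p < x"
  shows "sparse
    (\<lambda>x. Suc (k ^ x * Suc (k ^ ramsey_number k (Suc p) * Suc (ramsey_number k (Suc x))))) X"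
  using assms(1) order_refl
proof (rule sparse_mono)
  fix x assume "x \<in> X"
  then have x: "2 \<le> x" "k \<le> x" "p < x" using assms(3) by auto
  let ?N = "ramsey_number k (Suc p)" and ?R = "ramsey_number k (Suc x)"
  have "3 \<le> ?R" using le_ramsey_number[OF assms(2), of "Suc x"] x(1) by linarith
  then have "?R + 3 \<le> 2 ^ ?R" by (induction rule: dec_induct) auto
  also have "\<dots> \<le> x ^ ?R" using x(1) by (intro power_mono) auto
  finally have R: "?R + 3 \<le> x ^ ?R" .
  have "1 \<le> k ^ ?N" "1 \<le> k ^ x * k ^ ?N" using assms(2) by simp_all
  have "Suc (k ^ x * Suc (k ^ ?N * Suc ?R)) = 1 + k ^ x * 1 + k ^ x * k ^ ?N * Suc ?R"
    by (simp add: algebra_simps)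
  also have "\<dots> \<le> k ^ x * k ^ ?N + k ^ x * k ^ ?N + k ^ x * k ^ ?N * Suc ?R"
    using \<open>1 \<le> k ^ ?N\<close> \<open>1 \<le> k ^ x * k ^ ?N\<close> by (intro add_mono mult_le_mono2 order_refl)
  also have "\<dots> = k ^ x * k ^ ?N * (?R + 3)" by (simp add: algebra_simps)
  also have "\<dots> \<le> x ^ x * x ^ ?N * x ^ ?R"
    using x(2) R by (intro mult_le_mono power_mono) auto
  also have "\<dots> = x ^ (x + ?N + ?R)" by (simp add: power_add)
  also have "\<dots> \<le> x ^ ramsey_number x (2 * x + 2)"
  proof (rule power_increasing)
    have "?N \<le> ramsey_number x x" "?R \<le> ramsey_number x (Suc x)"
      using assms(2) x(2,3) by (auto intro!: ramsey_number_mono)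
    then show "x + ?N + ?R \<le> ramsey_number x (2 * x + 2)"
      using ramsey_number_double_ge[of x] x(1) by linarith
  qed (use x(1) in simp)
  finally show "Suc (k ^ x * Suc (k ^ ?N * Suc ?R)) \<le> x ^ ramsey_number x (2 * x + 2)" .
qed

section \<open>Homogeneous sequences of blocks\<close>

definition interleaved ::
  "(nat \<Rightarrow> nat set \<Rightarrow> bool) \<Rightarrow> nat set \<Rightarrow> nat \<Rightarrow> (nat \<Rightarrow> nat) \<Rightarrow> (nat \<Rightarrow> nat set) \<Rightarrow> bool" where
  "interleaved P X N v D \<longleftrightarrow>
    (\<forall>j<N. v j \<in> X \<and> D j \<subseteq> X \<and> {v j} \<lless> D j \<and> P (v j) (D j)) \<and> (\<forall>j<N. \<forall>i<j. D i \<lless> {v j})"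

lemma interleavedD:
  assumes "interleaved P X N v D" "j < N"
  shows "v j \<in> X" "D j \<subseteq> X" "{v j} \<lless> D j" "P (v j) (D j)" "\<And>i. i < j \<Longrightarrow> D i \<lless> {v j}"
  using assms by (auto simp: interleaved_def)

lemma interleaved_less_sets:
  assumes "interleaved P X N v D" "i < j" "j < N"
  shows "D i \<lless> D j"
  using interleavedD(3,5)[OF assms(1,3)] assms(2) by (fastforce simp: less_sets_def)

lemma interleaved_subset:
  assumes "interleaved P X N v D" "\<And>j. j < N \<Longrightarrow> D' j \<subseteq> D j" "\<And>j. j < N \<Longrightarrow> Q (v j) (D' j)"
  shows "interleaved Q X N v D'"
  unfolding interleaved_def
proof (intro conjI allI impI)
  fix j assume "j < N"
  note j = interleavedD[OF assms(1) this] assms(2,3)[OF this]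
  show "v j \<in> X" "D' j \<subseteq> X" "{v j} \<lless> D' j" "Q (v j) (D' j)"
    using j(1-4,6,7) by (auto elim: less_sets_mono)
  show "D' i \<lless> {v j}" if "i < j" for i
    using j(5)[OF that] assms(2)[of i] \<open>j < N\<close> that by (auto elim: less_sets_mono)
qed

definition cross_constant :: "(nat set \<Rightarrow> 'b) \<Rightarrow> nat \<Rightarrow> (nat \<Rightarrow> nat set) \<Rightarrow> 'b \<Rightarrow> bool" where
  "cross_constant f N D c \<longleftrightarrow> (\<forall>j<N. \<forall>i<j. \<forall>x\<in>D i. \<forall>y\<in>D j. f {x, y} = c)"

lemma interleaved_reindex:
  assumes "interleaved P X N v D" "\<And>i. i < M \<Longrightarrow> h i < N" "\<And>i j. i < j \<Longrightarrow> j < M \<Longrightarrow> h i < h j"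
  shows "interleaved P X M (v \<circ> h) (D \<circ> h)"
  using assms by (simp add: interleaved_def)

locale sparse_coloring =
  fixes X :: "nat set" and f :: "nat set \<Rightarrow> nat" and k :: nat
  assumes finite_X: "finite X"
    and zero_notin: "0 \<notin> X"
    and sparse_quadratic: "sparse (\<lambda>x. x * Suc x) X"
    and coloring: "f \<in> [X]\<^bsup>2\<^esup> \<rightarrow> {..<k}"
    and k_pos: "0 < k"
begin

lemma color_less: "x \<in> X \<Longrightarrow> y \<in> X \<Longrightarrow> x < y \<Longrightarrow> f {x, y} < k"
  using coloring by (simp add: funcset_nsets_2_iff)

lemma ex_constant_subset:
  assumes "F \<subseteq> X" "finite I" "card I \<le> l" "\<And>x. x \<in> F \<Longrightarrow> k ^ l \<le> x"
    and "\<And>i x. i \<in> I \<Longrightarrow> x \<in> F \<Longrightarrow> \<phi> i x < k" "pow_times_large s (Suc (k ^ l * m)) F"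
  shows "\<exists>D\<subseteq>F. pow_times_large s m D \<and> (\<forall>i\<in>I. \<forall>x\<in>D. \<forall>y\<in>D. \<phi> i x = \<phi> i y)"
proof (rule pow_times_large_ex_constant_subset[where C = "{..<k}", OF _ assms(2) _ _ _ _ assms(6)])
  show "finite F" using assms(1) finite_X by (rule finite_subset)
  show "card {..<k} ^ card I \<le> k ^ l" using assms(3) k_pos by (simp add: power_increasing)
  show "sparse (\<lambda>x. k ^ l * Suc x) F"
    using sparse_quadratic assms(1) by (rule sparse_mono) (intro mult_le_mono1 assms(4))
qed (use assms(5) in simp_all)

lemma ex_constant_from_below_subset:
  assumes "B \<subseteq> X" "pow_large (Suc s) B"
    and above: "\<And>b. b \<in> B \<Longrightarrow> w < b \<and> Suc (k ^ w * Suc m) < b"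
  shows "\<exists>D\<subseteq>B \<inter> {..<Max B}. pow_times_large s (Suc m) D \<and>
    (\<forall>y\<in>X \<inter> {..w}. \<forall>x\<in>D. \<forall>x'\<in>D. f {y, x} = f {y, x'})"
proof -
  have fin: "finite B" using assms(1) finite_X by (rule finite_subset)
  from assms(2) obtain e where e: "e \<in> B" "pow_times_large s e (B \<inter> {e<..})" by auto
  define F where "F = B \<inter> {e<..} \<inter> {..<Max (B \<inter> {e<..})}"
  have "Suc (Suc (k ^ w * Suc m)) \<le> e" using above[OF e(1)] by simp
  then have "pow_times_large s (Suc (Suc (k ^ w * Suc m))) (B \<inter> {e<..})"
    by (rule contains_consecutive_mono[OF e(2)]) simp
  then have F_large: "pow_times_large s (Suc (k ^ w * Suc m)) F"
    unfolding F_def using fin by (intro pow_times_large_butlast) simp_all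
  have F: "F \<subseteq> B \<inter> {..<Max B}"
  proof
    fix x assume "x \<in> F"
    then have x: "x \<in> B" "x \<in> B \<inter> {e<..}" "x < Max (B \<inter> {e<..})" by (auto simp: F_def)
    moreover have "Max (B \<inter> {e<..}) \<le> Max B" using x(2) fin by (intro Max_mono) auto
    ultimately show "x \<in> B \<inter> {..<Max B}" by simp
  qed
  have "X \<inter> {..w} \<subseteq> {1..w}" using zero_notin by (auto simp: Suc_le_eq intro: gr0I)
  then have "card (X \<inter> {..w}) \<le> w" using card_mono[of "{1..w}" "X \<inter> {..w}"] by simp
  have "\<exists>D\<subseteq>F. pow_times_large s (Suc m) D \<and>
      (\<forall>y\<in>X \<inter> {..w}. \<forall>x\<in>D. \<forall>x'\<in>D. f {y, x} = f {y, x'})"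
  proof (rule ex_constant_subset[OF _ _ \<open>card (X \<inter> {..w}) \<le> w\<close> _ _ F_large])
    show "k ^ w \<le> x" if "x \<in> F" for x
      using above[of x] F that by fastforce
    show "f {y, x} < k" if "y \<in> X \<inter> {..w}" "x \<in> F" for y x
      using above[of x] F that assms(1) by (intro color_less) auto
  qed (use F assms(1) finite_X in auto)
  with F show ?thesis by (meson subset_trans)
qed

text \<open>
  Blocks are thinned twice: first so that each earlier point of \<open>X\<close> sees a single color in the
  block, then so that all points of the block see the same color in each later block.
\<close>

lemma ex_interleaved_pointwise_constant:
  assumes g: "sparse (\<lambda>x. Suc (k ^ x * Suc (g x))) X"
    and "pow_times_large (Suc s) (Suc N) X"
  shows "\<exists>v D. interleaved (\<lambda>u. pow_times_large s (Suc (g u))) X N v D \<and>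
    (\<forall>j<N. \<forall>y\<in>X \<inter> {..v j}. \<forall>x\<in>D j. \<forall>x'\<in>D j. f {y, x} = f {y, x'})"
proof -
  obtain B where B: "\<And>j. j \<le> N \<Longrightarrow> B j \<subseteq> X" "\<And>j. j \<le> N \<Longrightarrow> pow_large (Suc s) (B j)"
    "\<And>i j. i < j \<Longrightarrow> j \<le> N \<Longrightarrow> B i \<lless> B j"
    by (rule contains_consecutiveE[OF assms(2), unfolded less_Suc_eq_le]) (rule that)
  define v where "v j = Max (B j)" for j
  have v: "v j \<in> B j" if "j \<le> N" for j
    using B(1,2)[OF that] finite_X not_pow_large_empty unfolding v_def
    by (metis Max_in finite_subset)
  have "\<exists>D. D \<subseteq> B (Suc j) \<inter> {..<v (Suc j)} \<and> pow_times_large s (Suc (g (v j))) D \<and>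
      (\<forall>y\<in>X \<inter> {..v j}. \<forall>x\<in>D. \<forall>x'\<in>D. f {y, x} = f {y, x'})" if "j < N" for j
    unfolding v_def[of "Suc j"]
  proof (rule ex_constant_from_below_subset)
    show "v j < b \<and> Suc (k ^ v j * Suc (g (v j))) < b" if "b \<in> B (Suc j)" for b
    proof
      show "v j < b" using less_setsD[OF B(3)[of j "Suc j"] v that] \<open>j < N\<close> by simp
      with sparseD[OF g] B(1) v that \<open>j < N\<close>
      show "Suc (k ^ v j * Suc (g (v j))) < b" by (meson Suc_leI less_imp_le subsetD)
    qed
  qed (use that B(1,2) in simp_all)
  then obtain D where D: "\<And>j. j < N \<Longrightarrow> D j \<subseteq> B (Suc j) \<inter> {..<v (Suc j)} \<and>
      pow_times_large s (Suc (g (v j))) (D j) \<and>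
      (\<forall>y\<in>X \<inter> {..v j}. \<forall>x\<in>D j. \<forall>x'\<in>D j. f {y, x} = f {y, x'})"
    by metis
  have "interleaved (\<lambda>u. pow_times_large s (Suc (g u))) X N v D"
    unfolding interleaved_def
  proof (intro conjI allI impI)
    fix j assume j: "j < N"
    show "v j \<in> X" "D j \<subseteq> X" "pow_times_large s (Suc (g (v j))) (D j)"
      using D[OF j] B(1)[of j] B(1)[of "Suc j"] v[of j] j by auto
    show "{v j} \<lless> D j"
      using D[OF j] less_setsD[OF B(3)[of j "Suc j"] v] j by (auto simp: less_sets_def)
    show "D i \<lless> {v j}" if "i < j" for i
      using D[of i] less_setsD[OF B(3)[of "Suc i" j] _ v] that j
      by (cases "Suc i = j") (fastforce simp: less_sets_def)+
  qed
  with D show ?thesis by blast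
qed

lemma interleaved_constant_at:
  assumes vD: "interleaved (\<lambda>u. pow_times_large s (Suc (k ^ N * g u))) X N v D"
    and d: "\<And>j. j < N \<Longrightarrow> d j \<in> D j" and "sparse (\<lambda>_. k ^ N) X"
  shows "\<exists>D'. interleaved (\<lambda>u. pow_times_large s (g u)) X N v D' \<and> (\<forall>j<N. D' j \<subseteq> D j) \<and>
    (\<forall>j<N. \<forall>i<j. \<forall>x\<in>D' i. \<forall>x'\<in>D' i. f {x, d j} = f {x', d j})"
proof -
  note D = interleavedD[OF vD]
  have "\<exists>D'\<subseteq>D i. pow_times_large s (g (v i)) D' \<and>
      (\<forall>j\<in>{i<..<N}. \<forall>x\<in>D'. \<forall>x'\<in>D'. f {x, d j} = f {x', d j})" if i: "i < N" for i
  proof (rule ex_constant_subset[OF D(2)[OF i] _ _ _ _ D(4)[OF i]])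
    show "k ^ N \<le> x" if "x \<in> D i" for x
      using sparseD[OF assms(3) D(1)[OF i], of x] D(2,3)[OF i] that by (auto simp: less_sets_def)
    show "f {x, d j} < k" if "j \<in> {i<..<N}" "x \<in> D i" for j x
      using that d[of j] D(2)[OF i] D(2)[of j]
        less_setsD[OF interleaved_less_sets[OF vD, of i j], of x "d j"]
      by (intro color_less) auto
  qed simp_all
  then obtain D' where D': "\<And>i. i < N \<Longrightarrow> D' i \<subseteq> D i \<and> pow_times_large s (g (v i)) (D' i) \<and>
      (\<forall>j\<in>{i<..<N}. \<forall>x\<in>D' i. \<forall>x'\<in>D' i. f {x, d j} = f {x', d j})"
    by metis
  then have "\<forall>j<N. \<forall>i<j. \<forall>x\<in>D' i. \<forall>x'\<in>D' i. f {x, d j} = f {x', d j}"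
    by (meson greaterThanLessThan_iff less_trans)
  moreover have "interleaved (\<lambda>u. pow_times_large s (g u)) X N v D'"
    using vD by (rule interleaved_subset) (use D' in auto)
  ultimately show ?thesis using D' by blast
qed

lemma ex_interleaved_blockwise_constant:
  assumes r: "sparse (\<lambda>x. Suc (k ^ x * Suc (k ^ N * Suc (r x)))) X"
    and "pow_times_large (Suc s) (Suc N) X"
  shows "\<exists>v D. interleaved (\<lambda>u. pow_times_large s (Suc (r u))) X N v D \<and>
    (\<forall>j<N. \<forall>i<j. \<forall>x\<in>D i. \<forall>x'\<in>D i. \<forall>y\<in>D j. \<forall>y'\<in>D j. f {x, y} = f {x', y'})"
proof -
  obtain v D where vD: "interleaved (\<lambda>u. pow_times_large s (Suc (k ^ N * Suc (r u)))) X N v D"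
    and below: "\<forall>j<N. \<forall>y\<in>X \<inter> {..v j}. \<forall>x\<in>D j. \<forall>x'\<in>D j. f {y, x} = f {y, x'}"
    using ex_interleaved_pointwise_constant[OF assms] by blast
  have "\<forall>j. \<exists>d. j < N \<longrightarrow> d \<in> D j"
    using pow_times_large_nonempty[OF interleavedD(4)[OF vD]] by blast
  then obtain d where d: "\<And>j. j < N \<Longrightarrow> d j \<in> D j" by metis
  have "sparse (\<lambda>_. k ^ N) X"
    using r order_refl
  proof (rule sparse_mono)
    fix x
    have "k ^ N * 1 \<le> k ^ N * Suc (r x)" by (intro mult_le_mono2) simp
    also have "\<dots> \<le> 1 * Suc (k ^ N * Suc (r x))" by simp
    also have "\<dots> \<le> k ^ x * Suc (k ^ N * Suc (r x))" using k_pos by (intro mult_le_mono1) simp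
    finally show "k ^ N \<le> Suc (k ^ x * Suc (k ^ N * Suc (r x)))" by simp
  qed
  from interleaved_constant_at[OF vD d this] obtain D' where
    D': "interleaved (\<lambda>u. pow_times_large s (Suc (r u))) X N v D'" "\<forall>j<N. D' j \<subseteq> D j"
    and at: "\<forall>j<N. \<forall>i<j. \<forall>x\<in>D' i. \<forall>x'\<in>D' i. f {x, d j} = f {x', d j}"
    by blast
  have "f {x, y} = f {x', y'}"
    if ij: "i < j" "j < N" and "x \<in> D' i" "x' \<in> D' i" "y \<in> D' j" "y' \<in> D' j" for i j x x' y y'
  proof -
    have to_d: "f {u, z} = f {u, d j}" if "u \<in> D' i" "z \<in> D' j" for u z
    proof -
      have "u \<in> X \<inter> {..v j}"
        using that(1) ij interleavedD(2)[OF D'(1), of i] interleavedD(5)[OF D'(1) ij(2,1)]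
        by (auto simp: less_sets_def)
      then show ?thesis using below d[OF ij(2)] D'(2) ij(2) that(2) by blast
    qed
    have "f {x, d j} = f {x', d j}" using at ij that(3,4) by blast
    with to_d that show ?thesis by metis
  qed
  with D'(1) show ?thesis by blast
qed

lemma ex_interleaved_constant:
  assumes "sparse (\<lambda>x. Suc (k ^ x * Suc (k ^ ramsey_number k M * Suc (r x)))) X"
    and "pow_times_large (Suc s) (Suc (ramsey_number k M)) X"
  shows "\<exists>c<k. \<exists>v D. interleaved (\<lambda>u. pow_times_large s (Suc (r u))) X M v D \<and>
    cross_constant f M D c"
proof -
  let ?R = "ramsey_number k M"
  obtain v D where vD: "interleaved (\<lambda>u. pow_times_large s (Suc (r u))) X ?R v D"
    and const: "\<forall>j<?R. \<forall>i<j. \<forall>x\<in>D i. \<forall>x'\<in>D i. \<forall>y\<in>D j. \<forall>y'\<in>D j. f {x, y} = f {x', y'}"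
    using ex_interleaved_blockwise_constant[OF assms] by blast
  note D = interleavedD[OF vD]
  have "\<forall>j. \<exists>d. j < ?R \<longrightarrow> d \<in> D j"
    using pow_times_large_nonempty[OF D(4)] by blast
  then obtain d where d: "\<And>j. j < ?R \<Longrightarrow> d j \<in> D j" by metis
  have "(\<lambda>e. f (d ` e)) \<in> [{..<?R}]\<^bsup>2\<^esup> \<rightarrow> {..<k}"
    unfolding funcset_nsets_2_iff
  proof (intro ballI impI)
    fix i j assume "i \<in> {..<?R}" "j \<in> {..<?R}" "i < j"
    then have "d i \<in> X" "d j \<in> X" "d i < d j"
      using d[of i] d[of j] D(2)[of i] D(2)[of j]
        less_setsD[OF interleaved_less_sets[OF vD, of i j], of "d i" "d j"] by auto
    then show "f (d ` {i, j}) \<in> {..<k}" using color_less by simp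
  qed
  then obtain c h where c: "c < k" and h: "\<And>i. i < M \<Longrightarrow> h i < ?R"
    and h_mono: "\<And>i j. i < j \<Longrightarrow> j < M \<Longrightarrow> h i < h j"
    and h_c: "\<And>i j. i < j \<Longrightarrow> j < M \<Longrightarrow> f (d ` {h i, h j}) = c"
    by (rule ramsey_number_homogeneousE[OF k_pos]) (rule that)
  have "f {x, y} = c" if "i < j" "j < M" "x \<in> D (h i)" "y \<in> D (h j)" for i j x y
  proof -
    from that have i: "i < M" by simp
    have "f {x, y} = f {d (h i), d (h j)}"
      using const h_mono[OF that(1,2)] h d that i by blast
    also have "\<dots> = c" using h_c[OF that(1,2)] by simp
    finally show ?thesis .
  qed
  then have "cross_constant f M (D \<circ> h) c" by (auto simp: cross_constant_def)
  moreover have "interleaved (\<lambda>u. pow_times_large s (Suc (r u))) X M (v \<circ> h) (D \<circ> h)"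
    using vD h h_mono by (rule interleaved_reindex)
  ultimately show ?thesis using c by blast
qed

end

section \<open>The partition theorem\<close>

definition meets_target ::
  "nat \<Rightarrow> (nat set \<Rightarrow> nat) \<Rightarrow> (nat \<Rightarrow> nat) \<Rightarrow> (nat \<Rightarrow> nat) \<Rightarrow> nat set \<Rightarrow> bool" where
  "meets_target k f b m X \<longleftrightarrow>
    (\<exists>c<k. \<exists>H\<subseteq>X. pow_times_large (b c) (m c) H \<and> f \<in> [H]\<^bsup>2\<^esup> \<rightarrow> {c})"

lemma meets_targetI:
  "c < k \<Longrightarrow> H \<subseteq> X \<Longrightarrow> pow_times_large (b c) (m c) H \<Longrightarrow> f \<in> [H]\<^bsup>2\<^esup> \<rightarrow> {c} \<Longrightarrow> meets_target k f b m X"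
  unfolding meets_target_def by blast

lemma meets_target_mono: "meets_target k f b m X \<Longrightarrow> X \<subseteq> Y \<Longrightarrow> meets_target k f b m Y"
  unfolding meets_target_def by blast

lemma meets_target_updD:
  assumes "meets_target k f (b(c := b')) (m(c := u)) X"
  shows "meets_target k f b m X \<or> (\<exists>H\<subseteq>X. pow_times_large b' u H \<and> f \<in> [H]\<^bsup>2\<^esup> \<rightarrow> {c})"
proof -
  from assms obtain i H where "i < k" "H \<subseteq> X" "f \<in> [H]\<^bsup>2\<^esup> \<rightarrow> {i}"
    "pow_times_large ((b(c := b')) i) ((m(c := u)) i) H"
    unfolding meets_target_def by blast
  then show ?thesis by (cases "i = c") (auto intro: meets_targetI)
qed

lemma funcset_nsets_2_UN_singleton:
  fixes H :: "'i::linorder \<Rightarrow> 'a::linorder set"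
  assumes "\<And>j. j \<in> J \<Longrightarrow> f \<in> [H j]\<^bsup>2\<^esup> \<rightarrow> {c}"
    and "\<And>i j. i \<in> J \<Longrightarrow> j \<in> J \<Longrightarrow> i < j \<Longrightarrow> H i \<lless> H j"
    and "\<And>i j x y. i \<in> J \<Longrightarrow> j \<in> J \<Longrightarrow> i < j \<Longrightarrow> x \<in> H i \<Longrightarrow> y \<in> H j \<Longrightarrow> f {x, y} = c"
  shows "f \<in> [\<Union>j\<in>J. H j]\<^bsup>2\<^esup> \<rightarrow> {c}"
  unfolding funcset_nsets_2_iff
proof (intro ballI impI)
  fix x y assume "x \<in> (\<Union>j\<in>J. H j)" "y \<in> (\<Union>j\<in>J. H j)" and "x < y"
  then obtain i j where ij: "i \<in> J" "x \<in> H i" "j \<in> J" "y \<in> H j" by blast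
  consider (less) "i < j" | (equal) "i = j" | (greater) "j < i" by (rule linorder_cases)
  then show "f {x, y} \<in> {c}"
  proof cases
    case less
    then show ?thesis using assms(3) ij by simp
  next
    case equal
    then show ?thesis using assms(1)[OF ij(1)] ij \<open>x < y\<close> by (simp add: funcset_nsets_2_iff)
  next
    case greater
    then show ?thesis using less_setsD[OF assms(2)[OF ij(3,1)] ij(4,2)] \<open>x < y\<close> by simp
  qed
qed

lemma interleaved_UN_homogeneous:
  assumes vD: "interleaved P X (Suc p) v D"
    and const: "cross_constant f (Suc p) D c"
    and F: "\<And>j. j \<le> p \<Longrightarrow> F j \<subseteq> D j" "\<And>j. j \<le> p \<Longrightarrow> f \<in> [F j]\<^bsup>2\<^esup> \<rightarrow> {c}"
  shows "f \<in> [\<Union>j\<le>p. F j]\<^bsup>2\<^esup> \<rightarrow> {c}"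
proof (rule funcset_nsets_2_UN_singleton)
  show "f {x, y} = c" if "i \<in> {..p}" "j \<in> {..p}" "i < j" "x \<in> F i" "y \<in> F j" for i j x y
    using const F(1)[of i] F(1)[of j] that
    by (auto simp: cross_constant_def less_Suc_eq_le dest!: subsetD)
  show "F i \<lless> F j" if "i \<in> {..p}" "j \<in> {..p}" "i < j" for i j
    using interleaved_less_sets[OF vD that(3)] F(1)[of i] F(1)[of j] that
    by (auto elim: less_sets_mono)
qed (use F(2) in simp)

lemma interleaved_UN_pow_times_large:
  assumes vD: "interleaved P X (Suc p) v D" and "finite X"
    and F: "\<And>j. j \<le> p \<Longrightarrow> F j \<subseteq> D j" "F 0 \<noteq> {}"
    and large: "\<And>j. 0 < j \<Longrightarrow> j \<le> p \<Longrightarrow> pow_times_large s (v j) (F j)"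
  shows "pow_times_large (Suc s) p (\<Union>j\<le>p. F j)"
proof (rule pow_times_large_UN)
  have v: "u < v j" if "i < j" "j \<le> p" "u \<in> F i" for i j u
    using interleavedD(5)[OF vD, of j i] F(1)[of i] that by (auto simp: less_sets_def)
  show "pow_times_large s (Suc u) (F j)" if "i \<in> {..p}" "j \<in> {..p}" "i < j" "u \<in> F i" for i j u
    using v[of i j u] that by (intro contains_consecutive_mono[OF large[of j]]) auto
  show "F j \<noteq> {}" if "j \<in> {..p}" for j
  proof (cases "j = 0")
    case False
    then have "0 < v j" using v[of 0 j] F(2) that by fastforce
    with False that show ?thesis using pow_times_large_nonempty[OF large] by simp
  qed (simp add: F(2))
  show "F i \<lless> F j" if "i \<in> {..p}" "j \<in> {..p}" "i < j" for i j
    using interleaved_less_sets[OF vD that(3)] F(1)[of i] F(1)[of j] that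
    by (auto elim: less_sets_mono)
  show "finite (F j)" if "j \<in> {..p}" for j
    using F(1)[of j] interleavedD(2)[OF vD, of j] that \<open>finite X\<close> by (auto intro: finite_subset)
qed simp_all

lemma meets_target_if_zero:
  assumes vD: "interleaved P X (Suc p) v D" and "cross_constant f (Suc p) D c"
    and "\<And>j. j \<le> p \<Longrightarrow> D j \<noteq> {}" "c < k" "b c = 0" "m c \<le> p"
  shows "meets_target k f b m X"
proof -
  have "\<forall>j. \<exists>d. j \<le> p \<longrightarrow> d \<in> D j" using assms(3) by blast
  then obtain d where d: "\<And>j. j \<le> p \<Longrightarrow> d j \<in> D j" by metis
  let ?H = "\<Union>j\<le>p. {d j}"
  have "f \<in> [?H]\<^bsup>2\<^esup> \<rightarrow> {c}"
    using d by (intro interleaved_UN_homogeneous[OF assms(1,2)]) (auto simp: nsets_singleton_iff)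
  moreover have "{d i} \<lless> {d j}" if "i < j" "j \<le> p" for i j
    using interleaved_less_sets[OF vD that(1)] d[of i] d[of j] that by (simp add: less_sets_def)
  then have "pow_times_large (b c) (m c) ?H"
    using assms(5,6) by (intro contains_consecutiveI[of _ "\<lambda>j. {d j}"]) auto
  moreover have "?H \<subseteq> X" using d interleavedD(2)[OF vD] by (auto simp: less_Suc_eq_le)
  ultimately show ?thesis using assms(4) by (intro meets_targetI)
qed

lemma meets_target_if_Suc:
  assumes vD: "interleaved P X (Suc p) v D" and "cross_constant f (Suc p) D c"
    and "D 0 \<noteq> {}" "c < k" "b c = Suc b'" "m c \<le> p" "finite X"
    and blocks: "\<And>j. 0 < j \<Longrightarrow> j \<le> p \<Longrightarrow> meets_target k f (b(c := b')) (m(c := v j)) (D j)"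
  shows "meets_target k f b m X"
proof (cases "\<exists>j\<le>p. 0 < j \<and> meets_target k f b m (D j)")
  case True
  then obtain j where "j < Suc p" "meets_target k f b m (D j)" using le_imp_less_Suc by blast
  with interleavedD(2)[OF vD] show ?thesis by (blast intro: meets_target_mono)
next
  case False
  then have "\<exists>H. H \<subseteq> D j \<and> pow_times_large b' (v j) H \<and> f \<in> [H]\<^bsup>2\<^esup> \<rightarrow> {c}"
    if "0 < j" "j \<le> p" for j
    using meets_target_updD[OF blocks[OF that]] that by blast
  then obtain H where H: "\<And>j. 0 < j \<Longrightarrow> j \<le> p \<Longrightarrow>
      H j \<subseteq> D j \<and> pow_times_large b' (v j) (H j) \<and> f \<in> [H j]\<^bsup>2\<^esup> \<rightarrow> {c}" by metis
  from \<open>D 0 \<noteq> {}\<close> obtain d where d: "d \<in> D 0" by blast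
  define F where "F = H(0 := {d})"
  have F: "F j \<subseteq> D j" "f \<in> [F j]\<^bsup>2\<^esup> \<rightarrow> {c}" if "j \<le> p" for j
    using H[OF _ that] d by (cases "j = 0"; simp add: F_def funcset_nsets_2_iff)+
  have "pow_times_large (Suc b') p (\<Union>j\<le>p. F j)"
    using vD \<open>finite X\<close> F(1)
    by (rule interleaved_UN_pow_times_large) (use H in \<open>auto simp: F_def\<close>)
  then have "pow_times_large (b c) (m c) (\<Union>j\<le>p. F j)"
    unfolding \<open>b c = Suc b'\<close> using \<open>m c \<le> p\<close> by (rule contains_consecutive_mono) simp
  moreover have "f \<in> [\<Union>j\<le>p. F j]\<^bsup>2\<^esup> \<rightarrow> {c}"
    using assms(1,2) F by (rule interleaved_UN_homogeneous)
  moreover have "(\<Union>j\<le>p. F j) \<subseteq> X"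
    using F(1) interleavedD(2)[OF vD] by (fastforce simp: less_Suc_eq_le)
  ultimately show ?thesis using assms(4) by (intro meets_targetI)
qed

lemma Suc_sum_fun_upd:
  fixes b :: "'a \<Rightarrow> nat"
  assumes "finite A" "c \<in> A" "b c = Suc b'"
  shows "Suc (\<Sum>i\<in>A. (b(c := b')) i) = (\<Sum>i\<in>A. b i)"
  using assms by (simp add: sum.remove[of A c])

lemma sparse_coloring_if_ramsey_sparse:
  assumes "finite X" "ramsey_sparse X" "\<And>x. x \<in> X \<Longrightarrow> 2 \<le> x" "f \<in> [X]\<^bsup>2\<^esup> \<rightarrow> {..<k}" "0 < k"
  shows "sparse_coloring X f k"
proof
  show "0 \<notin> X" using assms(3)[of 0] by auto
  show "sparse (\<lambda>x. x * Suc x) X" using assms(2,3) by (rule ramsey_sparse_quadratic)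
qed (fact assms)+

lemma meets_target_if_ramsey_number_le_card:
  assumes "finite X" "0 < k" "f \<in> [X]\<^bsup>2\<^esup> \<rightarrow> {..<k}" "ramsey_number k d \<le> card X"
    and target: "\<And>i. i < k \<Longrightarrow> b i = 0 \<and> m i \<le> d"
  shows "meets_target k f b m X"
proof -
  have "partn X d 2 {..<k}" using assms(1,2,4) ramsey_number_le_card_iff by blast
  then obtain c H where c: "c \<in> {..<k}" and H: "H \<in> [X]\<^bsup>d\<^esup>" "f \<in> [H]\<^bsup>2\<^esup> \<rightarrow> {c}"
    using assms(3) by (rule partnE)
  from H(1) have "finite H" "H \<subseteq> X" "card H = d" by (auto simp: nsets_def)
  then have "pow_times_large 0 (m c) H"
    using target c by (simp only: pow_times_large_0_iff) simp
  with \<open>H \<subseteq> X\<close> H(2) target c show ?thesis by (intro meets_targetI[of c _ H]) simp_all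
qed

lemma ex_interleaved_constant_if_ramsey_sparse:
  assumes "finite X" "ramsey_sparse X" "\<And>x. x \<in> X \<Longrightarrow> 2 \<le> x \<and> k \<le> x \<and> p < x" "0 < k"
    and "f \<in> [X]\<^bsup>2\<^esup> \<rightarrow> {..<k}" "pow_times_large (Suc s) (Suc (ramsey_number k (Suc p))) X"
  shows "\<exists>c<k. \<exists>v D.
    interleaved (\<lambda>u. pow_times_large s (Suc (ramsey_number k (Suc u)))) X (Suc p) v D \<and>
    cross_constant f (Suc p) D c"
proof -
  interpret sparse_coloring X f k
    using assms by (intro sparse_coloring_if_ramsey_sparse) auto
  show ?thesis
    using ramsey_sparse_exponential[OF assms(2,4,3)] assms(6) by (rule ex_interleaved_constant)
qed

lemma meets_target_if_pow_times_large:
  assumes "finite X" "ramsey_sparse X" "\<And>x. x \<in> X \<Longrightarrow> p < x" "k \<le> p" "0 < k"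
    and "f \<in> [X]\<^bsup>2\<^esup> \<rightarrow> {..<k}" "\<And>i. i < k \<Longrightarrow> m i \<le> p"
    and "pow_times_large (\<Sum>i<k. b i) (Suc (ramsey_number k (Suc p))) X"
  shows "meets_target k f b m X"
  using assms(1-4,6-8)
proof (induction "\<Sum>i<k. b i" arbitrary: X p m b)
  case 0
  have "ramsey_number k (Suc p) \<le> card X"
    using 0(8) unfolding 0(1)[symmetric] pow_times_large_0_iff[OF 0(2)] by simp
  moreover have "b i = 0 \<and> m i \<le> Suc p" if "i < k" for i
    using 0(1) 0(7)[OF that] that by simp
  ultimately show ?case by (rule meets_target_if_ramsey_number_le_card[OF 0(2) \<open>0 < k\<close> 0(6)])
next
  case (Suc s)
  note X = Suc.prems(1-5) and m_le = Suc.prems(6) and large = Suc.prems(7)[folded Suc.hyps(2)]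
  have X_ge: "2 \<le> x \<and> k \<le> x \<and> p < x" if "x \<in> X" for x
    using X(3)[OF that] X(4) \<open>0 < k\<close> by simp
  obtain c v D where c: "c < k"
    and vD: "interleaved (\<lambda>u. pow_times_large s (Suc (ramsey_number k (Suc u)))) X (Suc p) v D"
    and const: "cross_constant f (Suc p) D c"
    using ex_interleaved_constant_if_ramsey_sparse[OF X(1,2) X_ge \<open>0 < k\<close> X(5) large] by blast
  note D = interleavedD[OF vD, unfolded less_Suc_eq_le]
  have nonempty: "D j \<noteq> {}" if "j \<le> p" for j
    using pow_times_large_nonempty[OF D(4)[OF that]] by simp
  show ?case
  proof (cases "b c")
    case 0
    with vD const nonempty c show ?thesis
      using m_le[OF c] by (rule meets_target_if_zero)
  next
    case (Suc b')
    have "meets_target k f (b(c := b')) (m(c := v j)) (D j)" if "j \<le> p" for j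
    proof (rule Suc.hyps(1))
      show "s = (\<Sum>i<k. (b(c := b')) i)"
        using Suc_sum_fun_upd[of "{..<k}" c b b'] c Suc Suc.hyps(2) by simp
      then show "pow_times_large (\<Sum>i<k. (b(c := b')) i) (Suc (ramsey_number k (Suc (v j)))) (D j)"
        using D(4)[OF that] by simp
      show "finite (D j)" using D(2)[OF that] X(1) by (rule finite_subset)
      show "ramsey_sparse (D j)" using X(2) D(2)[OF that] order_refl by (rule sparse_mono)
      show "v j < x" if "x \<in> D j" for x
        using D(3)[OF \<open>j \<le> p\<close>] that by (simp add: less_sets_def)
      show "f \<in> [D j]\<^bsup>2\<^esup> \<rightarrow> {..<k}" using X(5) D(2)[OF that] by (rule funcset_nsets_subset)
      show "k \<le> v j" using X_ge[OF D(1)[OF that]] by simp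
      show "(m(c := v j)) i \<le> v j" if "i < k" for i
        using X_ge[OF D(1)[OF \<open>j \<le> p\<close>]] m_le[OF that] by simp
    qed
    with vD const nonempty[OF le0] c Suc m_le[OF c] X(1)
    show ?thesis by (rule meets_target_if_Suc)
  qed
qed

lemma ex_constant_from_point:
  assumes "finite X" "ramsey_sparse X" "\<And>x. x \<in> X \<Longrightarrow> k \<le> x" "0 < k"
    and "f \<in> [X]\<^bsup>2\<^esup> \<rightarrow> {..<k}" "pow_times_large (Suc s) 3 X"
  shows "\<exists>c<k. \<exists>x\<in>X. \<exists>D\<subseteq>X. {x} \<lless> D \<and> (\<forall>y\<in>D. f {x, y} = c) \<and>
    pow_times_large s (Suc (ramsey_number k (Suc x))) D"
proof -
  obtain u where u: "u \<in> X" "pow_times_large (Suc s) (Suc 1) (X \<inter> {u<..})"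
    using pow_times_large_tl[of "Suc s" 2 X] assms(6) by (auto simp: numeral_3_eq_3 numeral_2_eq_2)
  let ?Y = "X \<inter> {u<..}"
  have Y_ge: "2 \<le> y \<and> k \<le> y \<and> 0 < y" if "y \<in> ?Y" for y
    using assms(3)[OF u(1)] assms(3,4) that by force
  have Y_sparse: "ramsey_sparse ?Y" using assms(2) by (rule sparse_mono) simp_all
  interpret sparse_coloring ?Y f k
    using assms(1,4) Y_sparse Y_ge funcset_nsets_subset[OF assms(5), of ?Y]
    by (intro sparse_coloring_if_ramsey_sparse) auto
  let ?g = "\<lambda>x. k ^ ramsey_number k (Suc 0) * Suc (ramsey_number k (Suc x))"
  obtain v D where vD: "interleaved (\<lambda>u. pow_times_large s (Suc (?g u))) ?Y 1 v D"
    and const: "\<forall>j<1. \<forall>y\<in>?Y \<inter> {..v j}. \<forall>x\<in>D j. \<forall>x'\<in>D j. f {y, x} = f {y, x'}"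
    using ex_interleaved_pointwise_constant[OF
        ramsey_sparse_exponential[OF Y_sparse assms(4) Y_ge] u(2)] by blast
  note D = interleavedD[OF vD zero_less_one]
  obtain z where z: "z \<in> D 0" using pow_times_large_nonempty[OF D(4)] by auto
  have "f {v 0, y} = f {v 0, z}" if "y \<in> D 0" for y
    using const[rule_format, OF zero_less_one _ that z, of "v 0"] D(1) by simp
  moreover have "f {v 0, z} < k"
    using D(1,2) z less_setsD[OF D(3)] by (intro color_less) auto
  moreover have "pow_times_large s (Suc (ramsey_number k (Suc (v 0)))) (D 0)"
  proof (rule contains_consecutive_mono[OF D(4)])
    have "1 * Suc (ramsey_number k (Suc (v 0))) \<le> ?g (v 0)"
      using assms(4) by (intro mult_le_mono1) simp
    then show "Suc (ramsey_number k (Suc (v 0))) \<le> Suc (?g (v 0))" by simp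
  qed simp
  ultimately show ?thesis using D(1-3) by blast
qed

lemma ex_homogeneous_pow_times_large:
  assumes "finite X" "ramsey_sparse X" "\<And>x. x \<in> X \<Longrightarrow> k \<le> x" "0 < k" "0 < n"
    and "f \<in> [X]\<^bsup>2\<^esup> \<rightarrow> {..<k}" "pow_times_large (k * n) 3 X"
  shows "\<exists>H\<subseteq>X. pow_times_large n 1 H \<and> homogeneous f H"
proof -
  obtain n' where n: "n = Suc n'" using assms(5) by (cases n) auto
  obtain s where s: "k * n = Suc s" using assms(4,5) by (cases "k * n") auto
  obtain c x D where c: "c < k" and x: "x \<in> X" "{x} \<lless> D" "\<forall>y\<in>D. f {x, y} = c"
    and D: "D \<subseteq> X" "pow_times_large s (Suc (ramsey_number k (Suc x))) D"
    using ex_constant_from_point[OF assms(1-4,6)] assms(7) unfolding s by blast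
  have "meets_target k f ((\<lambda>_. n)(c := n')) ((\<lambda>_. 1)(c := x)) D"
  proof (rule meets_target_if_pow_times_large)
    have "Suc (\<Sum>i<k. ((\<lambda>_. n)(c := n')) i) = Suc s"
      using Suc_sum_fun_upd[of "{..<k}" c "\<lambda>_. n" n'] c n s by simp
    then show "pow_times_large (\<Sum>i<k. ((\<lambda>_. n)(c := n')) i) (Suc (ramsey_number k (Suc x))) D"
      using D(2) by simp
    show "ramsey_sparse D" using assms(2) D(1) order_refl by (rule sparse_mono)
    show "f \<in> [D]\<^bsup>2\<^esup> \<rightarrow> {..<k}" using assms(6) D(1) by (rule funcset_nsets_subset)
    show "finite D" using D(1) assms(1) by (rule finite_subset)
    show "((\<lambda>_. 1)(c := x)) i \<le> x" for i using assms(3)[OF x(1)] assms(4) by simp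
  qed (use x(2) assms(3,4) x(1) in \<open>auto simp: less_sets_def\<close>)
  from meets_target_updD[OF this] consider (original) "meets_target k f (\<lambda>_. n) (\<lambda>_. 1) D"
    | (lowered) H where "H \<subseteq> D" "pow_times_large n' x H" "f \<in> [H]\<^bsup>2\<^esup> \<rightarrow> {c}"
    by blast
  then show ?thesis
  proof cases
    case original
    then obtain H where "H \<subseteq> D" "pow_times_large n 1 H" "homogeneous f H"
      unfolding meets_target_def homogeneous_iff by blast
    with D(1) show ?thesis by blast
  next
    case (lowered H)
    have less: "{x} \<lless> H" using x(2) order_refl lowered(1) by (rule less_sets_mono)
    then have "pow_large n (insert x H)"
      unfolding n using lowered(2) by (intro pow_large_SucI) auto
    then have "pow_times_large n 1 (insert x H)"
      by (intro contains_consecutiveI[of _ "\<lambda>_. insert x H"]) simp_all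
    moreover have "f \<in> [insert x H]\<^bsup>2\<^esup> \<rightarrow> {c}"
      using lowered(1,3) x(3) less by (auto simp: funcset_nsets_2_iff less_sets_def)
    ultimately show ?thesis using lowered(1) D(1) x(1) unfolding homogeneous_iff by blast
  qed
qed

theorem mainTheorem17:
  fixes n k :: nat and X :: "nat set" and f :: "nat set \<Rightarrow> nat"
  assumes "n \<ge> 1" and "k \<ge> 1"
    and "finite X"
    and "large (omega_pow_times (cnf_of_nat (k * n)) 4) X"
    and "sparse (\<lambda>x. x ^ ramsey_number x (2 * x + 2)) X"
    and "k * n \<le> Min X"
    and "f \<in> [X]\<^bsup>2\<^esup> \<rightarrow> {..<k}"
  shows "\<exists>H\<subseteq>X. large (omega_pow_times (cnf_of_nat n) 1) H \<and> homogeneous f H"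
proof -
  have "pow_times_large (k * n) 3 X"
    using large_imp_pow_times_large[OF assms(4)] by (rule contains_consecutive_mono) simp_all
  moreover have "k \<le> x" if "x \<in> X" for x
  proof -
    have "k \<le> k * n" using assms(1) by simp
    also have "\<dots> \<le> x" using assms(6) Min_le[OF assms(3) that] by (rule order_trans)
    finally show ?thesis .
  qed
  ultimately obtain H where H: "H \<subseteq> X" "pow_times_large n 1 H" "homogeneous f H"
    using ex_homogeneous_pow_times_large[of X k n f] assms(1-3,5,7) by auto
  from pow_times_large_imp_large[OF H(2)] obtain H' where
    H': "H' \<subseteq> H" "large (omega_pow_times (cnf_of_nat n) 1) H'" by blast
  with H(1,3) show ?thesis using homogeneous_subset by blast
qed

end
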